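(* Let $\Omega$ be a complete ultrametric valued field with norm $|\cdot|$, let $q\in\Omega$ with $|q|>1$, and let $$F(x,w_0,\dots,w_n)=\sum_{k,k_0,\dots,k_n\ge 0}A_{k,k_0,\dots,k_n}x^kw_0^{k_0}\cdots w_n^{k_n}\in\Omega[[x,w_0,\dots,w_n]]$$ be a power series with $F(0,\dots,0)=0$ which is analytic at $0$, i.e. $$\limsup_{k+\sum_i k_i\to\infty}|A_{k,k_0,\dots,k_n}|^{\frac{1}{k+\sum_i k_i}}<+\infty.$$ Let $\varphi(x)\in x\Omega[[x]]$ be a formal solution of the equation $$F(x,\varphi(x),\varphi(qx),\dots,\varphi(q^nx))=0,$$ let $\mathcal{F}_\varphi$ be the linearized $q$-difference operator of $F$ along $\varphi$, and let $r\in\,]0,+\infty]$ be the smallest positive slope of the Newton polygon $N_q(\mathcal{F}_\varphi)$. If $$\frac{\partial F}{\partial w_n}(x,\varphi(x),\varphi(qx),\dots,\varphi(q^nx))\neq 0$$ in $\Omega[[x]]$, then $\varphi(x)$ is a $q$-Gevrey series of order $1/r$ (with the convention $1/(+\infty)=0$).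
   Context: For $\varphi(x)=\sum_h\varphi_hx^h\in\Omega[[x]]$, put $\varphi(q^ix)=\sum_h q^{ih}\varphi_hx^h$ and let $\sigma_q:\Omega[[x]]\to\Omega[[x]]$ be $\sigma_q\varphi(x)=\varphi(qx)$. Linearized operator: writing $\Phi=(\varphi(x),\varphi(qx),\dots,\varphi(q^nx))$, the linearized $q$-difference operator of $F$ along $\varphi\in x\Omega[[x]]$ is $\mathcal{F}_\varphi=\sum_{i=0}^n\frac{\partial F}{\partial w_i}(x,\Phi)\,\sigma_q^i$. Newton polygon: for a linear $q$-difference operator $\mathcal{L}=\sum_{i=0}^n a_i(x)\sigma_q^i$ with $a_i(x)\in\Omega[[x]]$ not all zero, $N_q(\mathcal{L})$ is the convex hull in $\mathbb{R}^2$ of $\bigcup_{i=0}^n\{(i,h): h\ge \operatorname{ord}_{x=0}a_i(x)\}$ (indices with $a_i=0$ contribute nothing). Its boundary consists of finitely many finite sides, with rational slopes, and two infinite vertical sides. By convention the right vertical side has slope $+\infty$ and the left vertical side has slope $-\infty$; thus the smallest positive slope is $+\infty$ if there is no finite side of positive slope. $q$-Gevrey series: $\varphi(x)=\sum_{h\ge 0}\varphi_hx^h\in\Omega[[x]]$ is a $q$-Gevrey series of order $s\in\mathbb{R}$ if the series $\sum_{h\ge 0}\frac{\varphi_h}{q^{s h(h-1)/2}}x^h$ is convergent (has positive radius of convergence), i.e. $\limsup_{h\to\infty}\left(|\varphi_h|\,|q|^{-s h(h-1)/2}\right)^{1/h}<+\infty$. *)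

theory Defs
  imports "HOL-Analysis.Analysis" "HOL-Computational_Algebra.Formal_Power_Series"
begin

text \<open>Complete ultrametric valued fields. The library constant \<open>norm\<close> is constrained to real vector
  spaces, so the norm is a separate constant; it induces the metric, whose axioms make it
  nonnegative and definite.\<close>

class complete_ultrametric_field = field + complete_space +
  fixes vnorm :: "'a \<Rightarrow> real"
  assumes dist_vnorm: "dist x y = vnorm (x - y)"
    and vnorm_mult: "vnorm (x * y) = vnorm x * vnorm y"
    and vnorm_add_le_max: "vnorm (x + y) \<le> max (vnorm x) (vnorm y)"

text \<open>A power series \<open>F(x, w\<^sub>0, \<dots>, w\<^sub>n)\<close> is given by its coefficients \<open>A k \<kappa>\<close>, the coefficient
  of \<open>x\<^sup>k w\<^sub>0\<^bsup>\<kappa> 0\<^esup> \<dots> w\<^sub>n\<^bsup>\<kappa> n\<^esup>\<close>, where \<open>\<kappa>\<close> vanishes beyond \<open>n\<close>; values of \<open>A\<close> at other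
  arguments are never used.\<close>

type_synonym 'a mseries = "nat \<Rightarrow> (nat \<Rightarrow> nat) \<Rightarrow> 'a"

definition mexps :: "nat \<Rightarrow> (nat \<times> (nat \<Rightarrow> nat)) set" where
  "mexps n = {(k, \<kappa>). \<forall>i>n. \<kappa> i = 0}"

definition mdeg :: "nat \<Rightarrow> nat \<times> (nat \<Rightarrow> nat) \<Rightarrow> nat" where
  "mdeg n = (\<lambda>(k, \<kappa>). k + (\<Sum>i\<le>n. \<kappa> i))"

text \<open>The filter expresses \<open>k + \<Sum>\<^sub>i k\<^sub>i \<rightarrow> \<infinity>\<close>.\<close>

definition mseries_analytic :: "nat \<Rightarrow> 'a::complete_ultrametric_field mseries \<Rightarrow> bool" where
  "mseries_analytic n A \<longleftrightarrow>
     Limsup (inf (filtercomap (mdeg n) at_top) (principal (mexps n)))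
       (\<lambda>(k, \<kappa>). ereal (root (mdeg n (k, \<kappa>)) (vnorm (A k \<kappa>)))) < \<infinity>"

definition mseries_deriv :: "nat \<Rightarrow> 'a::semiring_1 mseries \<Rightarrow> 'a mseries" where
  "mseries_deriv i A = (\<lambda>k \<kappa>. of_nat (Suc (\<kappa> i)) * A k (\<kappa>(i := Suc (\<kappa> i))))"

text \<open>Substitution \<open>F(x, \<psi> 0, \<dots>, \<psi> n)\<close>, meaningful when every \<open>\<psi> i\<close> has zero constant term: then
  a monomial of total degree above \<open>m\<close> does not contribute to the coefficient of \<open>x\<^sup>m\<close>
  (see \<open>mseries_subst_nth\<close> below).\<close>

definition mseries_subst :: "nat \<Rightarrow> 'a::comm_ring_1 mseries \<Rightarrow> (nat \<Rightarrow> 'a fps) \<Rightarrow> 'a fps" where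
  "mseries_subst n A \<psi> = Abs_fps (\<lambda>m.
     \<Sum>(k, \<kappa>) \<in> {e \<in> mexps n. mdeg n e \<le> m}.
       A k \<kappa> * fps_nth (fps_X ^ k * (\<Prod>i\<le>n. \<psi> i ^ \<kappa> i)) m)"

lemma finite_mexps_le: "finite {e \<in> mexps n. mdeg n e \<le> m}"
proof (rule finite_subset)
  let ?B = "{\<kappa>. \<forall>i. (i \<in> {..n} \<longrightarrow> \<kappa> i \<in> {..m}) \<and> (i \<notin> {..n} \<longrightarrow> \<kappa> i = (0::nat))}"
  show "{e \<in> mexps n. mdeg n e \<le> m} \<subseteq> {..m} \<times> ?B"
  proof clarsimp
    fix k \<kappa> assume a: "(k, \<kappa>) \<in> mexps n" "mdeg n (k, \<kappa>) \<le> m"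
    have "\<kappa> i \<le> m" if "i \<le> n" for i
      using member_le_sum[of i "{..n}" \<kappa>] that a(2) by (simp add: mdeg_def)
    then show "k \<le> m \<and> (\<forall>i. (i \<le> n \<longrightarrow> \<kappa> i \<le> m) \<and> (\<not> i \<le> n \<longrightarrow> \<kappa> i = 0))"
      using a by (auto simp: mexps_def mdeg_def)
  qed
  show "finite ({..m} \<times> ?B)"
    by (intro finite_cartesian_product finite_set_of_finite_funs) auto
qed

lemma fps_nth_prod_power_below:
  fixes \<psi> :: "nat \<Rightarrow> 'a::comm_ring_1 fps"
  assumes "\<And>i. i \<le> n \<Longrightarrow> fps_nth (\<psi> i) 0 = 0" and "m < mdeg n (k, \<kappa>)"
  shows "fps_nth (fps_X ^ k * (\<Prod>i\<le>n. \<psi> i ^ \<kappa> i)) m = 0"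
proof -
  have "fps_X dvd \<psi> i" if "i \<le> n" for i
  proof
    show "\<psi> i = fps_X * fps_shift 1 (\<psi> i)"
      using assms(1)[OF that] by (auto simp: fps_eq_iff)
  qed
  then have "(\<Prod>i\<le>n. fps_X ^ \<kappa> i) dvd (\<Prod>i\<le>n. \<psi> i ^ \<kappa> i)"
    by (intro prod_dvd_prod dvd_power_same) auto
  then have "fps_X ^ mdeg n (k, \<kappa>) dvd fps_X ^ k * (\<Prod>i\<le>n. \<psi> i ^ \<kappa> i)"
    by (simp add: mdeg_def power_add power_sum mult_dvd_mono)
  then obtain g where "fps_X ^ k * (\<Prod>i\<le>n. \<psi> i ^ \<kappa> i) = fps_X ^ mdeg n (k, \<kappa>) * g" ..
  then show ?thesis
    using assms(2) by (simp add: fps_X_power_mult_nth)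
qed

lemma mseries_subst_nth:
  fixes \<psi> :: "nat \<Rightarrow> 'a::comm_ring_1 fps"
  assumes "\<And>i. i \<le> n \<Longrightarrow> fps_nth (\<psi> i) 0 = 0" and "m \<le> N"
  shows "fps_nth (mseries_subst n A \<psi>) m =
    fps_nth (\<Sum>(k, \<kappa>) \<in> {e \<in> mexps n. mdeg n e \<le> N}.
      fps_const (A k \<kappa>) * (fps_X ^ k * (\<Prod>i\<le>n. \<psi> i ^ \<kappa> i))) m"
proof -
  have "(\<Sum>(k, \<kappa>) \<in> {e \<in> mexps n. mdeg n e \<le> N}. A k \<kappa> * fps_nth (fps_X ^ k * (\<Prod>i\<le>n. \<psi> i ^ \<kappa> i)) m)
      = (\<Sum>(k, \<kappa>) \<in> {e \<in> mexps n. mdeg n e \<le> m}. A k \<kappa> * fps_nth (fps_X ^ k * (\<Prod>i\<le>n. \<psi> i ^ \<kappa> i)) m)"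
  proof (rule sum.mono_neutral_right[OF finite_mexps_le])
    show "\<forall>e \<in> {e \<in> mexps n. mdeg n e \<le> N} - {e \<in> mexps n. mdeg n e \<le> m}.
        (case e of (k, \<kappa>) \<Rightarrow> A k \<kappa> * fps_nth (fps_X ^ k * (\<Prod>i\<le>n. \<psi> i ^ \<kappa> i)) m) = 0"
    proof
      fix e assume "e \<in> {e \<in> mexps n. mdeg n e \<le> N} - {e \<in> mexps n. mdeg n e \<le> m}"
      moreover obtain k \<kappa> where e: "e = (k, \<kappa>)" by (cases e)
      ultimately have "m < mdeg n (k, \<kappa>)" by (auto simp: not_le)
      with assms(1) have "fps_nth (fps_X ^ k * (\<Prod>i\<le>n. \<psi> i ^ \<kappa> i)) m = 0"
        by (rule fps_nth_prod_power_below)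
      then show "(case e of (k, \<kappa>) \<Rightarrow>
          A k \<kappa> * fps_nth (fps_X ^ k * (\<Prod>i\<le>n. \<psi> i ^ \<kappa> i)) m) = 0"
        by (simp only: e prod.case mult_zero_right)
    qed
  qed (use assms(2) in auto)
  then show ?thesis
    by (simp add: mseries_subst_def fps_sum_nth case_prod_beta)
qed

text \<open>\<open>q_dilate q i \<phi>\<close> is \<open>\<phi>(q\<^sup>i x)\<close>, that is, \<open>\<sigma>\<^sub>q\<^sup>i \<phi>\<close>.\<close>

definition q_dilate :: "'a::comm_ring_1 \<Rightarrow> nat \<Rightarrow> 'a fps \<Rightarrow> 'a fps" where
  "q_dilate q i \<phi> = Abs_fps (\<lambda>h. q ^ (i * h) * fps_nth \<phi> h)"

lemma q_dilate_eq_funpow: "q_dilate q i = (q_dilate q 1 ^^ i)"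
proof (induction i)
  case 0
  show ?case by (simp add: q_dilate_def fun_eq_iff fps_eq_iff)
next
  case (Suc i)
  have "q_dilate q (Suc i) \<phi> = q_dilate q 1 (q_dilate q i \<phi>)" for \<phi>
    by (simp add: q_dilate_def fps_eq_iff power_add)
  with Suc show ?case by (simp add: fun_eq_iff)
qed

text \<open>A linear \<open>q\<close>-difference operator \<open>\<Sum>i\<le>n. a i \<sigma>\<^sub>q\<^sup>i\<close> is represented by its
  coefficient family \<open>a\<close>; here are the coefficients of the linearization along \<open>\<phi>\<close>.\<close>

definition linearized ::
  "nat \<Rightarrow> 'a::comm_ring_1 \<Rightarrow> 'a mseries \<Rightarrow> 'a fps \<Rightarrow> nat \<Rightarrow> 'a fps" where
  "linearized n q A \<phi> i = mseries_subst n (mseries_deriv i A) (\<lambda>j. q_dilate q j \<phi>)"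

definition newton_polygon :: "nat \<Rightarrow> (nat \<Rightarrow> 'a::zero fps) \<Rightarrow> (real \<times> real) set" where
  "newton_polygon n a =
     convex hull (\<Union>i\<in>{i. i \<le> n \<and> a i \<noteq> 0}. {(real i, h) | h. h \<ge> real (subdegree (a i))})"

text \<open>The finite sides are the bounded edges; the two infinite values are the conventional slopes
  of the vertical sides.\<close>

definition newton_slopes :: "nat \<Rightarrow> (nat \<Rightarrow> 'a::zero fps) \<Rightarrow> ereal set" where
  "newton_slopes n a = {-\<infinity>, \<infinity>} \<union>
     {ereal ((y' - y) / (x' - x)) | x y x' y'.
        \<exists>e. e edge_of newton_polygon n a \<and> bounded e \<and>
            (x, y) \<in> e \<and> (x', y') \<in> e \<and> (x, y) \<noteq> (x', y')}"

text \<open>Convergence is expressed through norms, since \<open>q\<^bsup>s h (h - 1) / 2\<^esup>\<close> need not exist in the field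
  for real \<open>s\<close>.\<close>

definition q_gevrey :: "'a::complete_ultrametric_field \<Rightarrow> real \<Rightarrow> 'a fps \<Rightarrow> bool" where
  "q_gevrey q s \<phi> \<longleftrightarrow>
     limsup (\<lambda>h. ereal (root h (vnorm (fps_nth \<phi> h) *
       vnorm q powr (- s * (real h * (real h - 1) / 2))))) < \<infinity>"

end

theory Submission
  imports Defs
begin

text \<open>Let \<open>m\<close> be the least order of the coefficients \<open>a i\<close> of the linearized operator, \<open>p\<close> the last
  index attaining it and \<open>\<rho> = 1/r\<close>. In the coefficient of \<open>x\<^bsup>h + m\<^esup>\<close> of the equation, \<open>\<phi>\<^sub>h\<close> occurs
  with a factor of norm \<open>c \<bar>q\<bar>\<^bsup>p h\<^esup>\<close> for large \<open>h\<close>, while \<open>\<phi>\<^bsub>h - t\<^esub>\<close> occurs linearly with \<open>q\<^bsup>i (h - t)\<^esup>\<close> only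
  for \<open>i \<le> p + \<rho> t\<close>, which is exactly compatible with the growth \<open>\<bar>q\<bar>\<^bsup>\<rho> h (h - 1) / 2\<^esup>\<close>. Expanding around
  a truncation of \<open>\<phi>\<close> at a high degree \<open>N\<close> makes the terms of degree at least two harmless, because
  each of their factors then uses up more than \<open>N\<close> of the total degree \<open>h + m\<close>. The bound
  \<open>\<bar>\<phi>\<^sub>h\<bar> \<le> C\<^bsup>h - N\<^esup> \<bar>q\<bar>\<^bsup>\<rho> h (h - 1) / 2\<^esup>\<close> follows by induction, with no base case; the shift of the
  exponent of \<open>C\<close> by \<open>N\<close> absorbs the geometric factors.\<close>

subsection \<open>The ultrametric norm\<close>

lemma vnorm_eq_dist: "vnorm x = dist x 0"
  for x :: "'a::complete_ultrametric_field"
  by (simp add: dist_vnorm)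

lemma vnorm_nonneg [simp]: "0 \<le> vnorm x"
  for x :: "'a::complete_ultrametric_field"
  by (simp add: vnorm_eq_dist)

lemma vnorm_eq_0_iff [simp]: "vnorm x = 0 \<longleftrightarrow> x = 0"
  for x :: "'a::complete_ultrametric_field"
  by (simp add: vnorm_eq_dist)

lemma vnorm_0 [simp]: "vnorm (0 :: 'a::complete_ultrametric_field) = 0"
  by simp

lemma vnorm_le_0_iff [simp]: "vnorm x \<le> 0 \<longleftrightarrow> x = 0"
  for x :: "'a::complete_ultrametric_field"
  by (simp add: vnorm_eq_dist)

lemma vnorm_pos_iff [simp]: "0 < vnorm x \<longleftrightarrow> x \<noteq> 0"
  for x :: "'a::complete_ultrametric_field"
  by (simp add: vnorm_eq_dist)

lemma vnorm_minus [simp]: "vnorm (- x) = vnorm x"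
  for x :: "'a::complete_ultrametric_field"
  by (metis dist_vnorm dist_commute diff_0 diff_0_right)

lemma vnorm_1 [simp]: "vnorm (1 :: 'a::complete_ultrametric_field) = 1"
  using vnorm_mult[of "1::'a" 1] by simp

lemma vnorm_power: "vnorm (x ^ k) = vnorm x ^ k"
  for x :: "'a::complete_ultrametric_field"
  by (induction k) (simp_all add: vnorm_mult)

lemma vnorm_add_le: "vnorm x \<le> c \<Longrightarrow> vnorm y \<le> c \<Longrightarrow> vnorm (x + y) \<le> c"
  for x :: "'a::complete_ultrametric_field"
  by (rule order_trans[OF vnorm_add_le_max]) simp

lemma vnorm_sum_le:
  fixes f :: "'b \<Rightarrow> 'a::complete_ultrametric_field"
  assumes "0 \<le> c" "\<And>x. x \<in> S \<Longrightarrow> vnorm (f x) \<le> c"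
  shows "vnorm (sum f S) \<le> c"
  using assms(2)
  by (induction S rule: infinite_finite_induct) (auto intro: vnorm_add_le assms(1))

lemma vnorm_of_nat_le_1: "vnorm (of_nat k :: 'a::complete_ultrametric_field) \<le> 1"
  by (induction k) (auto intro: vnorm_add_le)

text \<open>Isosceles principle: if the norm dropped, \<open>x = (x + y) - y\<close> would be a sum
  of two elements smaller than \<open>x\<close>. It turns a dominant term into an exact
  norm.\<close>

lemma vnorm_add_eq_left:
  fixes x :: "'a::complete_ultrametric_field"
  assumes "vnorm y < vnorm x"
  shows "vnorm (x + y) = vnorm x"
proof (rule antisym)
  show "vnorm (x + y) \<le> vnorm x"
    using assms by (intro vnorm_add_le) auto
  show "vnorm x \<le> vnorm (x + y)"
    using vnorm_add_le_max[of "x + y" "- y"] assms by simp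
qed

lemma vnorm_fps_mult_nth_le:
  fixes f g :: "'a::complete_ultrametric_field fps"
  assumes "0 \<le> c" "\<And>a b. a + b = j \<Longrightarrow> vnorm (fps_nth f a) * vnorm (fps_nth g b) \<le> c"
  shows "vnorm (fps_nth (f * g) j) \<le> c"
  unfolding fps_mult_nth by (rule vnorm_sum_le) (auto simp: vnorm_mult assms)

subsection \<open>Weighted majorants and first-order jets\<close>

text \<open>The cutoff \<open>L\<close> reflects that an induction knows only finitely many
  coefficients. The weight \<open>w\<close> is kept apart from \<open>B\<close> because weights
  multiply over the factors of a monomial.\<close>

definition majorized ::
  "(nat \<Rightarrow> real) \<Rightarrow> nat \<Rightarrow> real \<Rightarrow> 'a::complete_ultrametric_field fps \<Rightarrow> bool" where
  "majorized B L w f \<longleftrightarrow> (\<forall>j<L. w * vnorm (fps_nth f j) \<le> B j)"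

lemma majorized_add:
  assumes "majorized B L w f" "majorized B L w g" "w > 0"
  shows "majorized B L w (f + g)"
  using assms unfolding majorized_def
  by (auto simp: pos_le_divide_eq[symmetric] mult.commute[of w] intro: vnorm_add_le)

text \<open>A Cauchy product with incomplete information: when one index leaves its known range,
  \<open>right\<close> or \<open>left\<close> forces the other coefficient to vanish.\<close>

lemma majorized_mult:
  assumes f: "majorized B L w f" and g: "majorized B' L' w' g" and w: "w > 0" "w' > 0"
    and nonneg: "\<And>j. 0 \<le> B'' j"
    and mult: "\<And>a b. a + b < K \<Longrightarrow> a < L \<Longrightarrow> b < L' \<Longrightarrow> B a * B' b \<le> B'' (a + b)"
    and right: "\<And>a b. a + b < K \<Longrightarrow> L \<le> a \<Longrightarrow> b < L' \<and> B' b = 0"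
    and left: "\<And>a b. a + b < K \<Longrightarrow> L' \<le> b \<Longrightarrow> a < L \<and> B a = 0"
  shows "majorized B'' K (w * w') (f * g)"
  unfolding majorized_def
proof (intro allI impI)
  fix j assume j: "j < K"
  have "vnorm (fps_nth (f * g) j) \<le> B'' j / (w * w')"
  proof (rule vnorm_fps_mult_nth_le)
    show "0 \<le> B'' j / (w * w')"
      using w nonneg by simp
    fix a b assume ab: "a + b = j"
    have "(w * vnorm (fps_nth f a)) * (w' * vnorm (fps_nth g b)) \<le> B'' j"
    proof -
      consider "a < L" "b < L'" | "L \<le> a" | "L' \<le> b" by linarith
      then show ?thesis
      proof cases
        case 1
        then have fa: "w * vnorm (fps_nth f a) \<le> B a" and gb: "w' * vnorm (fps_nth g b) \<le> B' b"
          using f g by (auto simp: majorized_def)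
        have "0 \<le> w * vnorm (fps_nth f a)" "0 \<le> w' * vnorm (fps_nth g b)"
          using w by simp_all
        then have "(w * vnorm (fps_nth f a)) * (w' * vnorm (fps_nth g b)) \<le> B a * B' b"
          using fa gb by (intro mult_mono) linarith+
        then show ?thesis
          using mult[of a b] 1 ab j by simp
      next
        case 2
        then have "w' * vnorm (fps_nth g b) \<le> 0"
          using g right[of a b] ab j by (auto simp: majorized_def)
        then have "fps_nth g b = 0"
          using w by (simp add: mult_le_0_iff)
        then show ?thesis by (simp add: nonneg)
      next
        case 3
        then have "w * vnorm (fps_nth f a) \<le> 0"
          using f left[of a b] ab j by (auto simp: majorized_def)
        then have "fps_nth f a = 0"
          using w by (simp add: mult_le_0_iff)
        then show ?thesis by (simp add: nonneg)
      qed
    qed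
    then show "vnorm (fps_nth f a) * vnorm (fps_nth g b) \<le> B'' j / (w * w')"
      using w by (simp add: field_simps)
  qed
  then show "w * w' * vnorm (fps_nth (f * g) j) \<le> B'' j"
    using w by (simp add: field_simps)
qed

text \<open>\<open>B0\<close>, \<open>B1\<close>, \<open>B2\<close> bound the parts of degree 0, 1
  and at least 2 in a perturbation, and products respect this grading. By \<open>gap\<close>, a
  first-order coefficient at an unknown index \<open>\<ge> H\<close> meets, below \<open>L\<close>,
  only vanishing coefficients of positive order.\<close>

locale jet_majorants =
  fixes B0 B1 B2 :: "nat \<Rightarrow> real" and H L :: nat
  assumes H_le_L: "H \<le> L"
    and B_nonneg: "0 \<le> B0 j" "0 \<le> B1 j" "0 \<le> B2 j"
    and B0_0: "1 \<le> B0 0"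
    and B00: "B0 a * B0 b \<le> B0 (a + b)"
    and B01: "B0 a * B1 b \<le> B1 (a + b)"
    and B02: "B0 a * B2 b \<le> B2 (a + b)"
    and B11: "B1 a * B1 b \<le> B2 (a + b)"
    and B12: "B1 a * B2 b \<le> B2 (a + b)"
    and B22: "B2 a * B2 b \<le> B2 (a + b)"
    and gap: "a + b < L \<Longrightarrow> H \<le> a \<Longrightarrow> b < H \<and> B1 b = 0 \<and> B2 b = 0"
begin

text \<open>\<open>f0\<close> and \<open>f1\<close> are the parts of \<open>f\<close> of degree 0 and 1 in a perturbation. Bounds on \<open>f1\<close>
  are only available below \<open>H\<close>.\<close>

definition jet ::
  "real \<Rightarrow> 'a::complete_ultrametric_field fps \<Rightarrow> 'a fps \<Rightarrow> 'a fps \<Rightarrow> bool" where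
  "jet w f f0 f1 \<longleftrightarrow> w > 0 \<and> majorized B0 L w f0 \<and> majorized B1 H w f1 \<and>
     majorized B2 L w (f - f0 - f1)"

lemma jet_mult:
  assumes "jet w f f0 f1" "jet w' g g0 g1"
  shows "jet (w * w') (f * g) (f0 * g0) (f0 * g1 + f1 * g0)"
proof -
  define f2 g2 where "f2 = f - f0 - f1" and "g2 = g - g0 - g1"
  note [simp] = B_nonneg
  have w: "w > 0" "w' > 0" "w * w' > 0"
    and f: "majorized B0 L w f0" "majorized B1 H w f1" "majorized B2 L w f2"
    and g: "majorized B0 L w' g0" "majorized B1 H w' g1" "majorized B2 L w' g2"
    using assms by (auto simp: jet_def f2_def g2_def)
  have B01': "B1 b * B0 a \<le> B1 (b + a)" and B02': "B2 b * B0 a \<le> B2 (b + a)"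
    and B12': "B2 b * B1 a \<le> B2 (b + a)" for a b
    using B01[of a b] B02[of a b] B12[of a b] by (simp_all add: mult.commute add.commute)
  have gap': "a + b < L \<Longrightarrow> H \<le> b \<Longrightarrow> a < H \<and> B1 a = 0 \<and> B2 a = 0" for a b
    using gap[of b a] by (simp add: add.commute)
  have 00: "majorized B0 L (w * w') (f0 * g0)"
    by (rule majorized_mult[OF f(1) g(1) w(1,2)]) (use B00 in auto)
  have "majorized B1 H (w * w') (f0 * g1)"
    by (rule majorized_mult[OF f(1) g(2) w(1,2)]) (use B01 H_le_L in auto)
  moreover have "majorized B1 H (w * w') (f1 * g0)"
    by (rule majorized_mult[OF f(2) g(1) w(1,2)]) (use B01' H_le_L in auto)
  ultimately have 1: "majorized B1 H (w * w') (f0 * g1 + f1 * g0)"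
    by (rule majorized_add) (rule w)
  have 02: "majorized B2 L (w * w') (f0 * g2)"
    by (rule majorized_mult[OF f(1) g(3) w(1,2)]) (use B02 in auto)
  have 20: "majorized B2 L (w * w') (f2 * g0)"
    by (rule majorized_mult[OF f(3) g(1) w(1,2)]) (use B02' in auto)
  \<comment> \<open>\<open>f1\<close> and \<open>g1\<close> are controlled below \<open>H\<close>,
    but the product is needed below \<open>L\<close>; \<open>gap\<close> removes the pairs in
    between.\<close>
  have 11: "majorized B2 L (w * w') (f1 * g1)"
    by (rule majorized_mult[OF f(2) g(2) w(1,2)]) (use B11 gap gap' in auto)
  have 12: "majorized B2 L (w * w') (f1 * g2)"
    by (rule majorized_mult[OF f(2) g(3) w(1,2)]) (use B12 gap gap' in fastforce)+
  have 21: "majorized B2 L (w * w') (f2 * g1)"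
    by (rule majorized_mult[OF f(3) g(2) w(1,2)]) (use B12' gap gap' in fastforce)+
  have 22: "majorized B2 L (w * w') (f2 * g2)"
    by (rule majorized_mult[OF f(3) g(3) w(1,2)]) (use B22 in auto)
  have "f * g - f0 * g0 - (f0 * g1 + f1 * g0) =
      f1 * g1 + (f0 * g2 + (f2 * g0 + (f1 * g2 + (f2 * g1 + f2 * g2))))"
    by (simp add: f2_def g2_def algebra_simps)
  moreover have "majorized B2 L (w * w') \<dots>"
    by (intro majorized_add 02 20 11 12 21 22 w)
  ultimately show ?thesis
    using 00 1 w by (simp add: jet_def)
qed

lemma jet_const:
  assumes "w > 0" "majorized B0 L w f"
  shows "jet w f f 0"
  using assms by (auto simp: jet_def majorized_def B_nonneg)

lemma jet_add:
  assumes "w > 0" "majorized B0 L w f" "majorized B1 H w g"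
  shows "jet w (f + g) f g"
  using assms by (auto simp: jet_def majorized_def B_nonneg)

lemma jet_1: "jet 1 1 1 0"
  by (rule jet_const) (use B0_0 B_nonneg in \<open>auto simp: majorized_def\<close>)

lemma jet_power:
  assumes "jet w f f0 f1"
  shows "jet (w ^ k) (f ^ k) (f0 ^ k) (of_nat k * f0 ^ (k - 1) * f1)"
proof (induction k)
  case 0
  show ?case using jet_1 by simp
next
  case (Suc k)
  have "f0 * (of_nat k * f0 ^ (k - 1) * f1) + f1 * f0 ^ k = of_nat (Suc k) * f0 ^ k * f1"
    by (cases k) (simp_all add: algebra_simps)
  with jet_mult[OF assms Suc] show ?case by simp
qed

lemma jet_prod:
  assumes "finite I" "\<And>i. i \<in> I \<Longrightarrow> jet (w i) (f i) (f0 i) (f1 i)"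
  shows "jet (\<Prod>i\<in>I. w i) (\<Prod>i\<in>I. f i) (\<Prod>i\<in>I. f0 i) (\<Sum>i\<in>I. f1 i * (\<Prod>j\<in>I - {i}. f0 j))"
  using assms
proof (induction I)
  case empty
  show ?case using jet_1 by simp
next
  case (insert x I)
  have "(\<Sum>i\<in>I. f1 i * (\<Prod>j\<in>insert x I - {i}. f0 j)) =
      (\<Sum>i\<in>I. f0 x * (f1 i * (\<Prod>j\<in>I - {i}. f0 j)))"
  proof (rule sum.cong)
    fix i assume "i \<in> I"
    then have "insert x I - {i} = insert x (I - {i})"
      using insert by auto
    then show "f1 i * (\<Prod>j\<in>insert x I - {i}. f0 j) = f0 x * (f1 i * (\<Prod>j\<in>I - {i}. f0 j))"
      using insert by simp
  qed simp
  moreover have "insert x I - {x} = I"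
    using insert by auto
  ultimately have "(\<Sum>i\<in>insert x I. f1 i * (\<Prod>j\<in>insert x I - {i}. f0 j)) =
      f0 x * (\<Sum>i\<in>I. f1 i * (\<Prod>j\<in>I - {i}. f0 j)) + f1 x * (\<Prod>j\<in>I. f0 j)"
    using insert by (simp add: sum_distrib_left)
  then show ?case
    using jet_mult[OF insert.prems[of x] insert.IH] insert by (simp add: add.commute)
qed

text \<open>The variable x counts as an unperturbed factor of the same weight, so the total weight
  is \<open>w\<close> to the total degree. This offsets the geometric growth of the coefficients of
  an analytic series.\<close>

lemma jet_monomial:
  fixes T \<Psi> :: "nat \<Rightarrow> 'a::complete_ultrametric_field fps"
  assumes "0 < w" "majorized B0 L w (fps_X :: 'a fps)"
    and "\<And>i. i \<le> n \<Longrightarrow> majorized B0 L w (T i)" "\<And>i. i \<le> n \<Longrightarrow> majorized B1 H w (\<Psi> i)"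
  shows "jet (w ^ mdeg n (k, \<kappa>)) (fps_X ^ k * (\<Prod>i\<le>n. (T i + \<Psi> i) ^ \<kappa> i))
     (fps_X ^ k * (\<Prod>i\<le>n. T i ^ \<kappa> i))
     (fps_X ^ k * (\<Sum>i\<le>n. of_nat (\<kappa> i) * T i ^ (\<kappa> i - 1) * \<Psi> i * (\<Prod>j\<in>{..n} - {i}. T j ^ \<kappa> j)))"
proof -
  have "jet (w ^ k) (fps_X ^ k :: 'a fps) (fps_X ^ k) (of_nat k * fps_X ^ (k - 1) * 0)"
    by (intro jet_power jet_const assms)
  moreover have "jet (\<Prod>i\<le>n. w ^ \<kappa> i) (\<Prod>i\<le>n. (T i + \<Psi> i) ^ \<kappa> i) (\<Prod>i\<le>n. T i ^ \<kappa> i)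
     (\<Sum>i\<le>n. of_nat (\<kappa> i) * T i ^ (\<kappa> i - 1) * \<Psi> i * (\<Prod>j\<in>{..n} - {i}. T j ^ \<kappa> j))"
    by (intro jet_prod jet_power jet_add assms) auto
  ultimately show ?thesis
    using jet_mult by (fastforce simp: mdeg_def power_add power_sum)
qed

end


subsection \<open>Substitution into analytic series\<close>

text \<open>The limsup controls large degrees; the finitely many coefficients of smaller positive
  degree are absorbed by adding their norms to \<open>R\<close>. Degree 0 uses that the constant
  term vanishes.\<close>

lemma mseries_analytic_bound:
  fixes A :: "'a::complete_ultrametric_field mseries"
  assumes "mseries_analytic n A" "A 0 (\<lambda>_. 0) = 0"
  obtains R where "1 \<le> R" "\<And>k \<kappa>. (k, \<kappa>) \<in> mexps n \<Longrightarrow> vnorm (A k \<kappa>) \<le> R ^ mdeg n (k, \<kappa>)"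
proof -
  from assms(1) obtain c where c: "Limsup (inf (filtercomap (mdeg n) at_top) (principal (mexps n)))
       (\<lambda>(k, \<kappa>). ereal (root (mdeg n (k, \<kappa>)) (vnorm (A k \<kappa>)))) < ereal c"
    unfolding mseries_analytic_def using ereal_dense2 by blast
  have "\<forall>\<^sub>F e in inf (filtercomap (mdeg n) at_top) (principal (mexps n)).
      (case e of (k, \<kappa>) \<Rightarrow> ereal (root (mdeg n (k, \<kappa>)) (vnorm (A k \<kappa>)))) < ereal c"
    using c by (rule Limsup_lessD)
  then obtain D where D: "\<And>k \<kappa>. D \<le> mdeg n (k, \<kappa>) \<Longrightarrow> (k, \<kappa>) \<in> mexps n \<Longrightarrow>
      root (mdeg n (k, \<kappa>)) (vnorm (A k \<kappa>)) < c"
    by (auto simp: eventually_inf_principal eventually_filtercomap_at_top_linorder)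
  define E where "E = {e \<in> mexps n. mdeg n e \<le> D}"
  define R where "R = 1 + \<bar>c\<bar> + (\<Sum>(k, \<kappa>)\<in>E. vnorm (A k \<kappa>))"
  have nonneg: "0 \<le> (\<Sum>(k, \<kappa>)\<in>E. vnorm (A k \<kappa>))"
    by (intro sum_nonneg) auto
  show ?thesis
  proof
    show "1 \<le> R"
      using nonneg by (simp add: R_def)
    fix k \<kappa> assume e: "(k, \<kappa>) \<in> mexps n"
    let ?d = "mdeg n (k, \<kappa>)"
    consider "?d = 0" | "?d \<noteq> 0" "?d \<le> D" | "?d \<noteq> 0" "D \<le> ?d" by linarith
    then show "vnorm (A k \<kappa>) \<le> R ^ ?d"
    proof cases
      case 1
      have "\<kappa> i = 0" for i
        by (cases "i \<le> n") (use 1 e in \<open>auto simp: mdeg_def mexps_def\<close>)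
      then have "\<kappa> = (\<lambda>_. 0)" "k = 0"
        using 1 by (auto simp: mdeg_def)
      with assms(2) 1 show ?thesis by simp
    next
      case 2
      have "vnorm (A k \<kappa>) \<le> (\<Sum>(k, \<kappa>)\<in>E. vnorm (A k \<kappa>))"
        using member_le_sum[of "(k, \<kappa>)" E "\<lambda>(k, \<kappa>). vnorm (A k \<kappa>)"] e 2
        by (auto simp: E_def finite_mexps_le)
      also have "\<dots> \<le> R" by (simp add: R_def)
      also have "\<dots> \<le> R ^ ?d"
        using \<open>1 \<le> R\<close> 2 by (intro self_le_power) auto
      finally show ?thesis .
    next
      case 3
      have "vnorm (A k \<kappa>) = root ?d (vnorm (A k \<kappa>)) ^ ?d"
        using 3 by simp
      also have "\<dots> \<le> R ^ ?d"
      proof (rule power_mono)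
        show "root ?d (vnorm (A k \<kappa>)) \<le> R"
          using D[OF 3(2) e] nonneg by (simp add: R_def)
      qed (simp add: real_root_ge_zero)
      finally show ?thesis .
    qed
  qed
qed

text \<open>Products and powers respect congruence modulo x^(m+1), hence so does substitution. This
  serves to compare derivatives along \<open>\<phi>\<close> with those along a truncation.\<close>

lemma mseries_subst_nth_cong:
  fixes \<psi> \<psi>' :: "nat \<Rightarrow> 'a::comm_ring_1 fps"
  assumes "\<And>i j. i \<le> n \<Longrightarrow> j \<le> m \<Longrightarrow> fps_nth (\<psi> i) j = fps_nth (\<psi>' i) j"
  shows "fps_nth (mseries_subst n A \<psi>) m = fps_nth (mseries_subst n A \<psi>') m"
proof -
  have mult: "\<forall>j\<le>m. fps_nth (f * g) j = fps_nth (f' * g') j"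
    if "\<forall>j\<le>m. fps_nth f j = fps_nth f' j" "\<forall>j\<le>m. fps_nth g j = fps_nth g' j"
    for f g f' g' :: "'a fps"
    using that by (auto simp: fps_mult_nth intro!: sum.cong)
  have power: "\<forall>j\<le>m. fps_nth (f ^ k) j = fps_nth (f' ^ k) j"
    if "\<forall>j\<le>m. fps_nth f j = fps_nth f' j" for f f' :: "'a fps" and k
    by (induction k) (auto simp: that intro!: mult[rule_format])
  have "\<forall>j\<le>m. fps_nth (\<Prod>i\<in>I. \<psi> i ^ \<kappa> i) j = fps_nth (\<Prod>i\<in>I. \<psi>' i ^ \<kappa> i) j"
    if "finite I" "I \<subseteq> {..n}" for I \<kappa>
    using that
    by induction (auto intro!: mult[rule_format] power[rule_format] assms)
  then have "\<forall>j\<le>m. fps_nth (fps_X ^ k * (\<Prod>i\<le>n. \<psi> i ^ \<kappa> i)) j =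
      fps_nth (fps_X ^ k * (\<Prod>i\<le>n. \<psi>' i ^ \<kappa> i)) j" for k \<kappa>
    by (intro mult) auto
  then show ?thesis
    by (simp add: mseries_subst_def)
qed

lemma mseries_subst_nth_bound:
  fixes A :: "'a::complete_ultrametric_field mseries"
  assumes A: "\<And>k \<kappa>. (k, \<kappa>) \<in> mexps n \<Longrightarrow> vnorm (A k \<kappa>) \<le> c * R ^ mdeg n (k, \<kappa>)"
    and "0 \<le> c" "1 \<le> R" "R \<le> M"
    and \<psi>: "\<And>i j. i \<le> n \<Longrightarrow> R * vnorm (fps_nth (\<psi> i) j) \<le> M ^ j"
  shows "vnorm (fps_nth (mseries_subst n A \<psi>) m) \<le> c * M ^ m"
proof -
  \<comment> \<open>With \<open>B1 = B2 = 0\<close> the jet calculus is a Cauchy estimate for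
    unperturbed monomials, and \<open>H = L\<close> makes \<open>gap\<close> vacuous.\<close>
  interpret jet_majorants "\<lambda>j. M ^ j" "\<lambda>_. 0" "\<lambda>_. 0" "Suc m" "Suc m"
    using assms(3,4) by unfold_locales (auto simp: power_add)
  have mon: "R ^ mdeg n (k, \<kappa>) * vnorm (fps_nth (fps_X ^ k * (\<Prod>i\<le>n. \<psi> i ^ \<kappa> i)) m) \<le> M ^ m" for k \<kappa>
    using jet_monomial[of R n \<psi> "\<lambda>_. 0" k \<kappa>] assms
    by (auto simp: jet_def majorized_def)
  show ?thesis
    unfolding mseries_subst_def fps_nth_Abs_fps
  proof (rule vnorm_sum_le)
    show "0 \<le> c * M ^ m"
      using assms by simp
    fix e assume "e \<in> {e \<in> mexps n. mdeg n e \<le> m}"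
    then obtain k \<kappa> where e: "e = (k, \<kappa>)" "(k, \<kappa>) \<in> mexps n" by (cases e) auto
    let ?x = "fps_nth (fps_X ^ k * (\<Prod>i\<le>n. \<psi> i ^ \<kappa> i)) m"
    have "vnorm (A k \<kappa> * ?x) \<le> c * (R ^ mdeg n (k, \<kappa>) * vnorm ?x)"
      using mult_right_mono[OF A[OF e(2)], of "vnorm ?x"] by (simp add: vnorm_mult mult.assoc)
    also have "\<dots> \<le> c * M ^ m"
      using mon assms(2) by (rule mult_left_mono)
    finally show "vnorm (case e of (k, \<kappa>) \<Rightarrow> A k \<kappa> * fps_nth (fps_X ^ k * (\<Prod>i\<le>n. \<psi> i ^ \<kappa> i)) m) \<le> c * M ^ m"
      by (simp add: e)
  qed
qed

text \<open>Integers have norm at most 1, so the factor from differentiation is free; the extra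
  \<open>R\<close> pays for the exponent raised by one.\<close>

lemma mseries_deriv_bound:
  fixes A :: "'a::complete_ultrametric_field mseries"
  assumes A: "\<And>k \<kappa>. (k, \<kappa>) \<in> mexps n \<Longrightarrow> vnorm (A k \<kappa>) \<le> R ^ mdeg n (k, \<kappa>)"
    and "i \<le> n" "(k, \<kappa>) \<in> mexps n"
  shows "vnorm (mseries_deriv i A k \<kappa>) \<le> R * R ^ mdeg n (k, \<kappa>)"
proof -
  let ?\<kappa> = "\<kappa>(i := Suc (\<kappa> i))"
  have "sum ?\<kappa> {..n} = Suc (sum \<kappa> {..n})"
    using \<open>i \<le> n\<close> by (simp add: sum.remove[of _ i])
  then have "mdeg n (k, ?\<kappa>) = Suc (mdeg n (k, \<kappa>))"
    by (simp add: mdeg_def)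
  moreover have "(k, ?\<kappa>) \<in> mexps n"
    using assms by (auto simp: mexps_def)
  ultimately have "vnorm (A k ?\<kappa>) \<le> R * R ^ mdeg n (k, \<kappa>)"
    using A[of k ?\<kappa>] by simp
  moreover have "vnorm (mseries_deriv i A k \<kappa>) \<le> 1 * vnorm (A k ?\<kappa>)"
    unfolding mseries_deriv_def vnorm_mult by (intro mult_right_mono vnorm_of_nat_le_1) simp
  ultimately show ?thesis by simp
qed

text \<open>Raising the exponent at \<open>i\<close> by one is a bijection onto the monomials of
  degree at most \<open>Suc N\<close> with positive exponent there; a zero exponent carries the
  factor \<open>of_nat 0\<close>.\<close>

lemma sum_mseries_deriv_reindex:
  fixes T :: "nat \<Rightarrow> 'a::comm_ring_1 fps"
  assumes "i \<le> n"
  shows "(\<Sum>(k, \<kappa>) \<in> {e \<in> mexps n. mdeg n e \<le> N}.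
        fps_const (mseries_deriv i A k \<kappa>) * (fps_X ^ k * (\<Prod>j\<le>n. T j ^ \<kappa> j))) =
    (\<Sum>(k, \<kappa>) \<in> {e \<in> mexps n. mdeg n e \<le> Suc N}.
        fps_const (A k \<kappa>) *
          (fps_X ^ k * (of_nat (\<kappa> i) * T i ^ (\<kappa> i - 1) * (\<Prod>j\<in>{..n} - {i}. T j ^ \<kappa> j))))"
    (is "_ = (\<Sum>(k, \<kappa>) \<in> ?S. ?g k \<kappa>)")
proof -
  have sum: "sum \<kappa> {..n} = \<kappa> i + sum \<kappa> ({..n} - {i})" for \<kappa> :: "nat \<Rightarrow> nat"
    using assms by (simp add: sum.remove)
  have upd: "sum (\<kappa>(i := c)) ({..n} - {i}) = sum \<kappa> ({..n} - {i})" for \<kappa> :: "nat \<Rightarrow> nat" and c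
    by (intro sum.cong) auto
  have prod: "(\<Prod>j\<le>n. T j ^ \<kappa> j) = T i ^ \<kappa> i * (\<Prod>j\<in>{..n} - {i}. T j ^ \<kappa> j)" for \<kappa>
    using assms by (simp add: prod.remove)
  have updp: "(\<Prod>j\<in>{..n} - {i}. T j ^ (\<kappa>(i := c)) j) = (\<Prod>j\<in>{..n} - {i}. T j ^ \<kappa> j)" for \<kappa> c
    by (intro prod.cong) auto
  have "(\<Sum>(k, \<kappa>) \<in> {e \<in> mexps n. mdeg n e \<le> N}.
        fps_const (mseries_deriv i A k \<kappa>) * (fps_X ^ k * (\<Prod>j\<le>n. T j ^ \<kappa> j))) =
      (\<Sum>(k, \<kappa>) \<in> {e \<in> ?S. snd e i \<noteq> 0}. ?g k \<kappa>)"
  proof (rule sum.reindex_bij_witness[where i = "\<lambda>(k, \<kappa>). (k, \<kappa>(i := \<kappa> i - 1))"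
        and j = "\<lambda>(k, \<kappa>). (k, \<kappa>(i := Suc (\<kappa> i)))"], goal_cases)
    case (5 e)
    obtain k \<kappa> where "e = (k, \<kappa>)" by (cases e)
    then show ?case
      by (simp add: prod updp mseries_deriv_def fps_of_nat[symmetric] fps_const_mult[symmetric]
          del: fps_const_mult of_nat_Suc)
  qed (use assms in \<open>auto simp: mexps_def mdeg_def sum upd\<close>)
  also have "\<dots> = (\<Sum>(k, \<kappa>) \<in> ?S. ?g k \<kappa>)"
    by (rule sum.mono_neutral_left) (auto simp: finite_mexps_le intro!: gr0I)
  finally show ?thesis .
qed

text \<open>As \<open>g\<close> has no constant term, only coefficients of the derivative below
  \<open>J\<close> matter. Truncation at degree \<open>J - 1\<close> is thus exact, and reindexing
  restores the range of degrees up to \<open>J\<close> used for \<open>A\<close> itself.\<close>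

lemma mseries_subst_deriv_mult_nth:
  fixes T :: "nat \<Rightarrow> 'a::comm_ring_1 fps"
  assumes T0: "\<And>i. i \<le> n \<Longrightarrow> fps_nth (T i) 0 = 0" and "fps_nth g 0 = 0" and "i \<le> n"
  shows "fps_nth (mseries_subst n (mseries_deriv i A) T * g) J =
    fps_nth (\<Sum>(k, \<kappa>) \<in> {e \<in> mexps n. mdeg n e \<le> J}. fps_const (A k \<kappa>) *
          (fps_X ^ k * (of_nat (\<kappa> i) * T i ^ (\<kappa> i - 1) * g * (\<Prod>j\<in>{..n} - {i}. T j ^ \<kappa> j)))) J"
proof (cases J)
  case 0
  then show ?thesis
    using assms(2) by (simp add: fps_sum_nth case_prod_beta)
next
  case (Suc N)
  have "fps_nth (mseries_subst n (mseries_deriv i A) T * g) J =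
    fps_nth ((\<Sum>(k, \<kappa>) \<in> {e \<in> mexps n. mdeg n e \<le> N}.
      fps_const (mseries_deriv i A k \<kappa>) * (fps_X ^ k * (\<Prod>j\<le>n. T j ^ \<kappa> j))) * g) J"
    unfolding fps_mult_nth[of _ g]
  proof (rule sum.cong)
    fix a assume "a \<in> {0..J}"
    then show "fps_nth (mseries_subst n (mseries_deriv i A) T) a * fps_nth g (J - a) =
      fps_nth (\<Sum>(k, \<kappa>) \<in> {e \<in> mexps n. mdeg n e \<le> N}.
        fps_const (mseries_deriv i A k \<kappa>) * (fps_X ^ k * (\<Prod>j\<le>n. T j ^ \<kappa> j))) a * fps_nth g (J - a)"
      using mseries_subst_nth[OF T0, where m = a and N = N and A = "mseries_deriv i A"] assms(2) Suc
      by (cases "a = J") auto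
  qed simp
  then show ?thesis
    unfolding sum_mseries_deriv_reindex[OF \<open>i \<le> n\<close>] Suc sum_distrib_right
    by (simp add: case_prod_beta mult_ac)
qed

text \<open>The weight of each monomial jet offsets the size of \<open>A\<close>, and the
  ultrametric inequality passes the common bound to the sum. Coefficients of \<open>\<Psi>\<close>
  from \<open>H\<close> on are unrestricted and appear in the explicit linear term.\<close>

lemma (in jet_majorants) mseries_subst_taylor:
  fixes A :: "'a::complete_ultrametric_field mseries"
  assumes A: "\<And>k \<kappa>. (k, \<kappa>) \<in> mexps n \<Longrightarrow> vnorm (A k \<kappa>) \<le> w ^ mdeg n (k, \<kappa>)"
    and "0 < w" "majorized B0 L w (fps_X :: 'a fps)"
    and T: "\<And>i. i \<le> n \<Longrightarrow> majorized B0 L w (T i)"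
    and \<Psi>: "\<And>i. i \<le> n \<Longrightarrow> majorized B1 H w (\<Psi> i)"
    and 0: "\<And>i. i \<le> n \<Longrightarrow> fps_nth (T i) 0 = 0" "\<And>i. i \<le> n \<Longrightarrow> fps_nth (\<Psi> i) 0 = 0"
    and "J < L"
  shows "vnorm (fps_nth (mseries_subst n A (\<lambda>i. T i + \<Psi> i)) J - fps_nth (mseries_subst n A T) J -
     (\<Sum>i\<le>n. fps_nth (mseries_subst n (mseries_deriv i A) T * \<Psi> i) J)) \<le> B2 J"
proof -
  let ?S = "{e \<in> mexps n. mdeg n e \<le> J}"
  define f f0 f1 where "f = (\<lambda>k \<kappa>. fps_X ^ k * (\<Prod>i\<le>n. (T i + \<Psi> i) ^ \<kappa> i))"
    and "f0 = (\<lambda>k \<kappa>. fps_X ^ k * (\<Prod>i\<le>n. T i ^ \<kappa> i))"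
    and "f1 = (\<lambda>k \<kappa> i. fps_X ^ k * (of_nat (\<kappa> i) * T i ^ (\<kappa> i - 1) * \<Psi> i * (\<Prod>j\<in>{..n} - {i}. T j ^ \<kappa> j)))"
  have rem: "vnorm (A k \<kappa>) * vnorm (fps_nth (f k \<kappa> - f0 k \<kappa> - (\<Sum>i\<le>n. f1 k \<kappa> i)) J) \<le> B2 J"
    if e: "(k, \<kappa>) \<in> mexps n" for k \<kappa>
  proof -
    have "jet (w ^ mdeg n (k, \<kappa>)) (f k \<kappa>) (f0 k \<kappa>) (\<Sum>i\<le>n. f1 k \<kappa> i)"
      using jet_monomial[of w n T \<Psi> k \<kappa>] assms by (simp add: f_def f0_def f1_def sum_distrib_left)
    then have "w ^ mdeg n (k, \<kappa>) * vnorm (fps_nth (f k \<kappa> - f0 k \<kappa> - (\<Sum>i\<le>n. f1 k \<kappa> i)) J) \<le> B2 J"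
      using \<open>J < L\<close> unfolding jet_def majorized_def by blast
    then show ?thesis
      using mult_right_mono[OF A[OF e]] by (meson order_trans vnorm_nonneg)
  qed
  have "fps_nth (mseries_subst n A (\<lambda>i. T i + \<Psi> i)) J = (\<Sum>(k, \<kappa>)\<in>?S. A k \<kappa> * fps_nth (f k \<kappa>) J)"
    by (simp add: mseries_subst_def f_def)
  moreover have "fps_nth (mseries_subst n A T) J = (\<Sum>(k, \<kappa>)\<in>?S. A k \<kappa> * fps_nth (f0 k \<kappa>) J)"
    by (simp add: mseries_subst_def f0_def)
  moreover have "(\<Sum>i\<le>n. fps_nth (mseries_subst n (mseries_deriv i A) T * \<Psi> i) J) =
      (\<Sum>i\<le>n. \<Sum>(k, \<kappa>)\<in>?S. A k \<kappa> * fps_nth (f1 k \<kappa> i) J)"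
    using 0 by (intro sum.cong)
      (auto simp: mseries_subst_deriv_mult_nth f1_def fps_sum_nth case_prod_beta)
  moreover have "\<dots> = (\<Sum>(k, \<kappa>)\<in>?S. A k \<kappa> * fps_nth (\<Sum>i\<le>n. f1 k \<kappa> i) J)"
    by (subst sum.swap) (simp add: sum_distrib_left fps_sum_nth case_prod_beta)
  ultimately have "fps_nth (mseries_subst n A (\<lambda>i. T i + \<Psi> i)) J - fps_nth (mseries_subst n A T) J -
     (\<Sum>i\<le>n. fps_nth (mseries_subst n (mseries_deriv i A) T * \<Psi> i) J) =
    (\<Sum>(k, \<kappa>)\<in>?S. A k \<kappa> * fps_nth (f k \<kappa> - f0 k \<kappa> - (\<Sum>i\<le>n. f1 k \<kappa> i)) J)"
    by (simp add: sum_subtractf case_prod_beta right_diff_distrib)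
  also have "vnorm \<dots> \<le> B2 J"
    by (rule vnorm_sum_le) (use rem B_nonneg in \<open>auto simp: vnorm_mult\<close>)
  finally show ?thesis .
qed

subsection \<open>The first positive slope\<close>

text \<open>A line below all the points supports the polygon. It is not vertical and the polygon
  lies over [0, n], so the face it cuts out is bounded; containing two distinct points of a line,
  that face is an edge.\<close>

lemma newton_slopes_supporting:
  fixes a :: "nat \<Rightarrow> 'a::zero fps" and \<sigma> :: real
  assumes "p < j" "j \<le> n" "a p \<noteq> 0" "a j \<noteq> 0"
    and \<sigma>: "real (subdegree (a j)) = subdegree (a p) + \<sigma> * (real j - real p)"
    and support: "\<And>i. i \<le> n \<Longrightarrow> a i \<noteq> 0 \<Longrightarrow> subdegree (a p) + \<sigma> * (real i - real p) \<le> subdegree (a i)"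
  shows "ereal \<sigma> \<in> newton_slopes n a"
proof -
  define G where "G = (\<Union>i\<in>{i. i \<le> n \<and> a i \<noteq> 0}. {(real i, h) | h. h \<ge> real (subdegree (a i))})"
  \<comment> \<open>Pairing with \<open>(- \<sigma>, 1)\<close> sends (x, y) to y - \<sigma> x, so
    \<open>b\<close> is the intercept of the supporting line.\<close>
  define b where "b = subdegree (a p) - \<sigma> * real p"
  define e where "e = newton_polygon n a \<inter> {z. (- \<sigma>, 1::real) \<bullet> z = b}"
  have N: "newton_polygon n a = convex hull G"
    by (simp add: newton_polygon_def G_def)
  have "G \<subseteq> {z. (- \<sigma>, 1::real) \<bullet> z \<ge> b}"
  proof
    fix z assume "z \<in> G"
    then obtain i h where "z = (real i, h)" "i \<le> n" "a i \<noteq> 0" "h \<ge> real (subdegree (a i))"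
      by (auto simp: G_def)
    with support[of i] show "z \<in> {z. (- \<sigma>, 1::real) \<bullet> z \<ge> b}"
      by (simp add: b_def algebra_simps)
  qed
  then have half: "newton_polygon n a \<subseteq> {z. (- \<sigma>, 1::real) \<bullet> z \<ge> b}"
    unfolding N by (rule hull_minimal) (rule convex_halfspace_ge)
  have face: "e face_of newton_polygon n a"
    unfolding e_def by (rule face_of_Int_supporting_hyperplane_ge) (use half N in auto)
  have "G \<subseteq> {0..real n} \<times> UNIV"
    by (auto simp: G_def)
  then have strip: "newton_polygon n a \<subseteq> {0..real n} \<times> UNIV"
    unfolding N by (rule hull_minimal) (intro convex_Times convex_UNIV convex_real_interval)
  have "e \<subseteq> (\<lambda>x. (x, b + \<sigma> * x)) ` {0..real n}"
    using strip by (auto simp: e_def image_iff)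
  moreover have "bounded ((\<lambda>x. (x, b + \<sigma> * x)) ` {0..real n})"
    by (intro compact_imp_bounded compact_continuous_image continuous_intros) simp
  ultimately have bdd: "bounded e"
    by (rule bounded_subset[rotated])
  have mem: "(real p, real (subdegree (a p))) \<in> e" "(real j, real (subdegree (a j))) \<in> e"
    using assms hull_subset[of G convex] by (auto simp: e_def N G_def b_def algebra_simps)
  have "aff_dim e \<le> aff_dim {z. (- \<sigma>, 1::real) \<bullet> z = b}"
    by (rule aff_dim_subset) (auto simp: e_def)
  also have "\<dots> = 1"
    by (subst aff_dim_hyperplane) (auto simp: zero_prod_def)
  finally have "aff_dim e \<le> 1" .
  moreover have "aff_dim {(real p, real (subdegree (a p))), (real j, real (subdegree (a j)))} \<le> aff_dim e"
    by (rule aff_dim_subset) (use mem in auto)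
  ultimately have "e edge_of newton_polygon n a"
    using face \<open>p < j\<close> by (simp add: edge_of_def)
  moreover have "\<sigma> = (real (subdegree (a j)) - real (subdegree (a p))) / (real j - real p)"
    using \<sigma> \<open>p < j\<close> by simp
  ultimately show ?thesis
    unfolding newton_slopes_def using bdd mem \<open>p < j\<close> by fastforce
qed

text \<open>Take the least slope from the point of \<open>p\<close> to a later one; it is positive
  because \<open>p\<close> is the last index of minimal order. The line supports on the right by
  minimality, and on the left it stays at or below the minimal order.\<close>

lemma exists_positive_slope:
  fixes a :: "nat \<Rightarrow> 'a::zero fps"
  assumes "p < n" "a p \<noteq> 0" "a n \<noteq> 0"
    and min: "\<And>i. i \<le> n \<Longrightarrow> a i \<noteq> 0 \<Longrightarrow> subdegree (a p) \<le> subdegree (a i)"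
    and last: "\<And>i. p < i \<Longrightarrow> i \<le> n \<Longrightarrow> a i \<noteq> 0 \<Longrightarrow> subdegree (a p) < subdegree (a i)"
  obtains \<sigma> :: real where "\<sigma> > 0" "ereal \<sigma> \<in> newton_slopes n a"
    "\<And>i. i \<le> n \<Longrightarrow> a i \<noteq> 0 \<Longrightarrow> subdegree (a p) + \<sigma> * (real i - real p) \<le> subdegree (a i)"
proof -
  define J where "J = {i. p < i \<and> i \<le> n \<and> a i \<noteq> 0}"
  define s where "s = (\<lambda>i. (real (subdegree (a i)) - subdegree (a p)) / (real i - real p))"
  have J: "finite J" "J \<noteq> {}"
    using assms by (auto simp: J_def)
  have "Min (s ` J) \<in> s ` J"
    using J by (intro Min_in) auto
  then obtain j where j: "j \<in> J" "Min (s ` J) = s j" by auto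
  have min_s: "s j \<le> s i" if "i \<in> J" for i
    using j(2) J that by (metis Min_le finite_imageI imageI)
  have pos: "s j > 0"
    using j last[of j] by (auto simp: s_def J_def)
  have support: "subdegree (a p) + s j * (real i - real p) \<le> subdegree (a i)" if "i \<le> n" "a i \<noteq> 0" for i
  proof (cases "p < i")
    case True
    then show ?thesis
      using min_s[of i] that by (simp add: J_def s_def field_simps)
  next
    case False
    then have "s j * (real i - real p) \<le> 0"
      using pos by (intro mult_nonneg_nonpos) auto
    then show ?thesis
      using min[OF that] by linarith
  qed
  have "ereal (s j) \<in> newton_slopes n a"
    using j assms support by (intro newton_slopes_supporting[of p j]) (auto simp: J_def s_def)
  with pos support show ?thesis using that by blast
qed


subsection \<open>The majorants\<close>

text \<open>The majorant of degree 2 rests on convexity: if \<open>j\<close> is a sum of at least two indices above \<open>N\<close>,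
  each of them is at most \<open>j - N - 1\<close>, so the sum of their \<open>a (a - 1)\<close> is at most \<open>j (j - N - 2)\<close>.\<close>

lemma qgevrey_jet_majorants:
  fixes Q R M C \<rho> :: real and n m N h :: nat
  assumes Q: "1 < Q" and R: "1 \<le> R" "R \<le> M" "M \<le> C" and \<rho>: "0 \<le> \<rho>"
    and N: "1 \<le> N" "m \<le> N" "N < h"
  shows "jet_majorants (\<lambda>j. M ^ j)
    (\<lambda>j. if N < j then R * C ^ (j - N) * Q powr (n * j + \<rho> * (real j * (real j - 1) / 2)) else 0)
    (\<lambda>j. if 2 * N + 2 \<le> j
       then R ^ 2 * C ^ (j - 2 * N) * Q powr (n * j + \<rho> * (real j * (real j - N - 2) / 2)) else 0)
    h (Suc (h + m))"
proof -
  define e1 where "e1 j = real (n * j) + \<rho> * (real j * (real j - 1) / 2)" for j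
  define e2 where "e2 j = real (n * j) + \<rho> * (real j * (real j - N - 2) / 2)" for j
  have C: "1 \<le> M" "1 \<le> C" "R \<le> C" using R by auto
  have combine: "u * Q powr x \<le> v * Q powr y" if "u \<le> v" "x \<le> y" "0 \<le> u" for u v x y
    using that Q by (intro mult_mono powr_mono) auto
  have step1: "e1 j \<le> e1 (i + j)" for i j
  proof -
    have "real j * (real j - 1) \<le> real (i + j) * (real (i + j) - 1)"
    proof (cases "j = 0")
      case True
      then show ?thesis by (cases i) auto
    next
      case False
      then show ?thesis by (intro mult_mono) auto
    qed
    then show ?thesis
      unfolding e1_def using \<rho> by (intro add_mono mult_left_mono divide_right_mono of_nat_mono mult_le_mono2) auto
  qed
  \<comment> \<open>The quadratic expression in \<open>e2 (i + j)\<close> splits into one share for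
    \<open>i\<close> and one for \<open>j\<close>; \<open>le1\<close> and \<open>le2\<close> compare
    each exponent with its share.\<close>
  have sum_le: "real (n * i) + \<rho> * (x / 2) + (real (n * j) + \<rho> * (y / 2)) \<le> e2 (i + j)"
    if "x \<le> real i * (real (i + j) - N - 2)" "y \<le> real j * (real (i + j) - N - 2)" for i j x y
  proof -
    have "\<rho> * ((x + y) / 2) \<le> \<rho> * ((real i * (real (i + j) - N - 2) + real j * (real (i + j) - N - 2)) / 2)"
      using that \<rho> by (intro mult_left_mono) auto
    also have "\<dots> = \<rho> * (real (i + j) * (real (i + j) - N - 2) / 2)"
      by (simp only: of_nat_add distrib_right)
    finally show ?thesis
      by (simp add: e2_def algebra_simps add_divide_distrib)
  qed
  have le1: "real i * (real i - 1) \<le> real i * (real (i + j) - N - 2)"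
    if "N < j" for i j
    using that by (intro mult_left_mono) auto
  have le2: "real i * (real i - N - 2) \<le> real i * (real (i + j) - N - 2)" for i j
    by (intro mult_left_mono) auto
  have e11: "e1 i + e1 j \<le> e2 (i + j)" if "N < i" "N < j" for i j
    unfolding e1_def using le1[of j i] le1[of i j] that by (intro sum_le) (auto simp: add.commute)
  have e12: "e1 i + e2 j \<le> e2 (i + j)" if "N < j" for i j
    unfolding e1_def e2_def[of j] using le1[of j i] le2[of j i] that by (intro sum_le) (auto simp: add.commute)
  have e22: "e2 i + e2 j \<le> e2 (i + j)" for i j
    unfolding e2_def[of i] e2_def[of j] using le2[of i j] le2[of j i] by (intro sum_le) (auto simp: add.commute)
  \<comment> \<open>The threshold \<open>2 * N + 2\<close>, the least sum of two indices above
    \<open>N\<close>, lies where j (j - N - 2) is nonnegative and increasing.\<close>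
  have step2: "e2 j \<le> e2 (i + j)" if "2 * N + 2 \<le> j" for i j
  proof -
    have "real j * (real j - N - 2) \<le> real (i + j) * (real (i + j) - N - 2)"
      using that by (intro mult_mono) auto
    then show ?thesis
      unfolding e2_def using \<rho> by (intro add_mono mult_left_mono divide_right_mono of_nat_mono mult_le_mono2) auto
  qed
  \<comment> \<open>A second-order factor times one of order 1 or 2 shifts the exponent of
    \<open>C\<close> by 3N or 4N instead of 2N. Each spare \<open>C ^ N\<close> pays for one surplus
    \<open>R\<close>.\<close>
  have RC: "R * x \<le> C ^ N * x" if "0 \<le> x" for x
    using C N self_le_power[of C N] that by (intro mult_right_mono) auto
  have MC: "M ^ i \<le> C ^ i" for i
    using R by (intro power_mono) auto
  show ?thesis
    unfolding e1_def[symmetric] e2_def[symmetric]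
  proof (unfold_locales, goal_cases)
    case (7 i j)
    show ?case
    proof (cases "N < j")
      case True
      then have "i + j - N = i + (j - N)" by simp
      then have "M ^ i * (R * C ^ (j - N)) \<le> R * C ^ (i + j - N)"
        using R C mult_mono[OF MC[of i] order_refl, of "R * C ^ (j - N)"]
        by (simp add: power_add mult_ac)
      from combine[OF this step1[of j i]] True show ?thesis
        using R C by (simp add: mult_ac)
    qed (use R C in auto)
  next
    case (8 i j)
    show ?case
    proof (cases "2 * N + 2 \<le> j")
      case True
      then have "i + j - 2 * N = i + (j - 2 * N)" by simp
      then have "M ^ i * (R ^ 2 * C ^ (j - 2 * N)) \<le> R ^ 2 * C ^ (i + j - 2 * N)"
        using R C mult_mono[OF MC[of i] order_refl, of "R ^ 2 * C ^ (j - 2 * N)"]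
        by (simp add: power_add mult_ac)
      from combine[OF this step2[of j i]] True show ?thesis
        using R C by (simp add: mult_ac)
    qed (use R C in auto)
  next
    case (9 i j)
    show ?case
    proof (cases "N < i \<and> N < j")
      case True
      then have "i + j - 2 * N = (i - N) + (j - N)" by simp
      then have "R * C ^ (i - N) * (R * C ^ (j - N)) \<le> R ^ 2 * C ^ (i + j - 2 * N)"
        by (simp add: power_add power2_eq_square mult_ac)
      from combine[OF this e11[of i j]] True show ?thesis
        using R C by (simp add: mult_ac powr_add)
    qed (use R C in auto)
  next
    case (10 i j)
    show ?case
    proof (cases "N < i \<and> 2 * N + 2 \<le> j")
      case True
      then have "i + j - 2 * N = N + (i - N) + (j - 2 * N)" by simp
      then have eq: "C ^ (i + j - 2 * N) = C ^ N * C ^ (i - N) * C ^ (j - 2 * N)"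
        by (simp only: power_add)
      have "R * (R ^ 2 * C ^ (i - N) * C ^ (j - 2 * N)) \<le> C ^ N * (R ^ 2 * C ^ (i - N) * C ^ (j - 2 * N))"
        using C by (intro RC) simp
      then have "R * C ^ (i - N) * (R ^ 2 * C ^ (j - 2 * N)) \<le> R ^ 2 * C ^ (i + j - 2 * N)"
        unfolding eq by (simp only: mult_ac)
      from combine[OF this e12[where i = i and j = j]] True show ?thesis
        using R C by (simp add: mult_ac powr_add)
    qed (use R C in auto)
  next
    case (11 i j)
    show ?case
    proof (cases "2 * N + 2 \<le> i \<and> 2 * N + 2 \<le> j")
      case True
      then have "i + j - 2 * N = N + N + (i - 2 * N) + (j - 2 * N)" by simp
      then have eq: "C ^ (i + j - 2 * N) = C ^ N * C ^ N * C ^ (i - 2 * N) * C ^ (j - 2 * N)"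
        by (simp only: power_add)
      define z where "z = R ^ 2 * C ^ (i - 2 * N) * C ^ (j - 2 * N)"
      have "0 \<le> z"
        using C by (simp add: z_def)
      then have "R * (R * z) \<le> C ^ N * (R * z)"
        using R by (intro RC) simp
      also have "\<dots> \<le> C ^ N * (C ^ N * z)"
        using C \<open>0 \<le> z\<close> by (intro mult_left_mono RC) auto
      finally have "R * (R * z) \<le> C ^ N * (C ^ N * z)" .
      then have "R ^ 2 * C ^ (i - 2 * N) * (R ^ 2 * C ^ (j - 2 * N)) \<le> R ^ 2 * C ^ (i + j - 2 * N)"
        unfolding eq z_def power2_eq_square by (simp only: mult_ac)
      from combine[OF this e22[of i j]] True show ?thesis
        using R C by (simp add: mult_ac powr_add)
    qed (use R C in auto)
  \<comment> \<open>This includes \<open>gap\<close>: an index at least \<open>h\<close> in a sum at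
    most \<open>h + m\<close> leaves at most \<open>m \<le> N\<close> for the other, where
    \<open>B1\<close> and \<open>B2\<close> vanish.\<close>
  qed (use R C N in \<open>auto simp: power_add\<close>)
qed

subsection \<open>The coefficient estimate\<close>

text \<open>The inequality \<open>slope\<close> is the supporting line of slope r through (p, m),
  multiplied by \<open>\<rho>\<close> = 1/r. In this form it also covers r = \<infinity>, where
  \<open>\<rho>\<close> = 0 and \<open>p = n\<close>.\<close>

lemma solution_coeff_bound:
  fixes q :: "'a::complete_ultrametric_field" and A :: "'a mseries" and \<phi> :: "'a fps"
  assumes q: "vnorm q > 1"
    and R: "1 \<le> R" "\<And>k \<kappa>. (k, \<kappa>) \<in> mexps n \<Longrightarrow> vnorm (A k \<kappa>) \<le> R ^ mdeg n (k, \<kappa>)"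
    and \<phi>0: "fps_nth \<phi> 0 = 0"
    and sol: "mseries_subst n A (\<lambda>i. q_dilate q i \<phi>) = 0"
    and "p \<le> n" and apm: "fps_nth (linearized n q A \<phi> p) m \<noteq> 0"
    and ord: "\<And>i j. i \<le> n \<Longrightarrow> j < m \<Longrightarrow> fps_nth (linearized n q A \<phi> i) j = 0"
    and slope: "\<And>i j. i \<le> n \<Longrightarrow> fps_nth (linearized n q A \<phi> i) j \<noteq> 0 \<Longrightarrow>
      real i - real p \<le> \<rho> * (real j - real m)"
    and \<rho>: "0 \<le> \<rho>" "p = n \<or> 0 < \<rho>"
  obtains C N where "1 \<le> C"
    "\<And>h. N < h \<Longrightarrow> vnorm (fps_nth \<phi> h) \<le> C ^ (h - N) * vnorm q powr (\<rho> * (real h * (real h - 1) / 2))"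
proof -

  \<comment> \<open>The dominant coefficient of the unknown term\<close>
  define Q where "Q = vnorm q"
  define a where "a = linearized n q A \<phi>"
  define c where "c = vnorm (fps_nth (a p) m)"
  define \<gamma> where "\<gamma> = (\<lambda>h. \<rho> * (real h * (real h - 1) / 2))"
  have Q: "1 < Q" using q by (simp add: Q_def)
  have c: "0 < c" using apm by (simp add: c_def a_def)
  have a_last: "fps_nth (a i) m = 0" if "i \<le> n" "p < i" for i
    using slope[OF that(1), of m] that by (auto simp: a_def)
  define S where "S = (\<Sum>i\<le>n. vnorm (fps_nth (a i) m))"
  have S0: "0 \<le> S"
    unfolding S_def by (intro sum_nonneg) simp
  obtain h0 where h0: "S / c < Q ^ h0"
    using real_arch_pow[OF Q] by blast
  \<comment> \<open>Terms with i > p vanish by \<open>a_last\<close>; those with i < p lose a factor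
    \<open>Q ^ h\<close>, which outweighs \<open>S / c\<close> from \<open>h0\<close> on.\<close>
  have main: "vnorm (\<Sum>i\<le>n. fps_nth (a i) m * q ^ (i * h)) = c * Q ^ (p * h)" if "h0 \<le> h" for h
  proof -
    have "vnorm (\<Sum>i\<in>{..n} - {p}. fps_nth (a i) m * q ^ (i * h)) \<le> S * Q ^ (p * h) / Q ^ h"
    proof (rule vnorm_sum_le)
      show "0 \<le> S * Q ^ (p * h) / Q ^ h"
        using Q S0 by simp
      fix i assume i: "i \<in> {..n} - {p}"
      show "vnorm (fps_nth (a i) m * q ^ (i * h)) \<le> S * Q ^ (p * h) / Q ^ h"
      proof (cases "i < p")
        case True
        then have "i * h + h \<le> p * h"
          by (metis Suc_leI add.commute mult_Suc mult_le_mono1)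
        then have "Q ^ (i * h) * Q ^ h \<le> Q ^ (p * h)"
          unfolding power_add[symmetric] using Q by (intro power_increasing) auto
        moreover have "vnorm (fps_nth (a i) m) \<le> S"
          unfolding S_def using i by (intro member_le_sum) auto
        ultimately have "vnorm (fps_nth (a i) m) * (Q ^ (i * h) * Q ^ h) \<le> S * Q ^ (p * h)"
          using Q S0 by (intro mult_mono) auto
        then have "vnorm (fps_nth (a i) m) * Q ^ (i * h) \<le> S * Q ^ (p * h) / Q ^ h"
          using Q by (simp add: pos_le_divide_eq mult.assoc)
        then show ?thesis
          by (simp add: vnorm_mult vnorm_power Q_def)
      next
        case False
        then show ?thesis
          using i a_last[of i] \<open>0 \<le> S * Q ^ (p * h) / Q ^ h\<close> by auto
      qed
    qed
    also have "\<dots> < c * Q ^ (p * h)"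
    proof -
      have "S < c * Q ^ h0"
        using h0 c by (simp add: field_simps)
      also have "\<dots> \<le> c * Q ^ h"
        using c Q that by (intro mult_left_mono power_increasing) auto
      finally show ?thesis
        using Q by (simp add: field_simps)
    qed
    also have "\<dots> = vnorm (fps_nth (a p) m * q ^ (p * h))"
      by (simp add: c_def vnorm_mult vnorm_power Q_def)
    finally have "vnorm (fps_nth (a p) m * q ^ (p * h) +
        (\<Sum>i\<in>{..n} - {p}. fps_nth (a i) m * q ^ (i * h))) = vnorm (fps_nth (a p) m * q ^ (p * h))"
      by (rule vnorm_add_eq_left)
    then show ?thesis
      using \<open>p \<le> n\<close> by (simp add: sum.remove[of _ p] c_def vnorm_mult vnorm_power Q_def)
  qed
  \<comment> \<open>\<open>h0\<close> gives \<open>main\<close>, \<open>2 * m + 1\<close> separates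
    the orders, and the ceiling gives \<open>N'\<close>. For \<open>\<rho>\<close> = 0 the quotient
    is 0 by convention, and then \<open>p = n\<close>.\<close>
  define N where "N = max h0 (2 * m + 1 + nat \<lceil>2 * real n / \<rho>\<rceil>)"
  have N: "h0 \<le> N" "2 * m + 1 \<le> N"
    by (auto simp: N_def)
  have N': "2 * real n \<le> \<rho> * (real N + 1 - 2 * real m)" if "0 < \<rho>"
  proof -
    have "2 * real n / \<rho> \<le> real N + 1 - 2 * real m"
      unfolding N_def by linarith
    then show ?thesis
      using that by (simp add: field_simps)
  qed

  \<comment> \<open>Truncation at degree \<open>N\<close> and derivatives along it\<close>
  define \<tau> where "\<tau> = fps_cutoff (Suc N) \<phi>"
  define T where "T = (\<lambda>i. q_dilate q i \<tau>)"
  define \<Psi> where "\<Psi> = (\<lambda>i. q_dilate q i (\<phi> - \<tau>))"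
  have T_nth: "fps_nth (T i) j = (if j \<le> N then q ^ (i * j) * fps_nth \<phi> j else 0)" for i j
    by (simp add: T_def q_dilate_def \<tau>_def)
  have \<Psi>_nth: "fps_nth (\<Psi> i) j = (if j \<le> N then 0 else q ^ (i * j) * fps_nth \<phi> j)" for i j
    by (simp add: \<Psi>_def q_dilate_def \<tau>_def)
  have T\<Psi>: "(\<lambda>i. T i + \<Psi> i) = (\<lambda>i. q_dilate q i \<phi>)"
    by (auto simp: fps_eq_iff T_nth \<Psi>_nth q_dilate_def fun_eq_iff)
  have vnorm_dilate: "vnorm (q ^ (i * j) * fps_nth \<phi> j) \<le> Q ^ (n * j) * vnorm (fps_nth \<phi> j)"
    if "i \<le> n" for i j
    unfolding vnorm_mult vnorm_power Q_def[symmetric]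
    using that Q by (intro mult_right_mono power_increasing) auto
  define s where "s = (\<Sum>j\<le>N. Q ^ (n * j) * vnorm (fps_nth \<phi> j))"
  define M where "M = R * (1 + s)"
  have "0 \<le> s" unfolding s_def using Q by (intro sum_nonneg) auto
  then have "R \<le> M"
    using R(1) mult_left_mono[of 1 "1 + s" R] by (simp add: M_def)
  with R(1) have M: "R \<le> M" "1 \<le> M" by auto
  have T_bound: "R * vnorm (fps_nth (T i) j) \<le> M ^ j" if i: "i \<le> n" for i j
  proof (cases "j \<le> N \<and> j \<noteq> 0")
    case True
    have "vnorm (fps_nth (T i) j) \<le> Q ^ (n * j) * vnorm (fps_nth \<phi> j)"
      using True vnorm_dilate[OF i, of j] by (simp add: T_nth)
    also have "\<dots> \<le> s"
      unfolding s_def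
      using True Q by (intro member_le_sum[of j "{..N}" "\<lambda>j. Q ^ (n * j) * vnorm (fps_nth \<phi> j)"]) auto
    finally have "R * vnorm (fps_nth (T i) j) \<le> M"
      unfolding M_def using R(1) by (intro mult_left_mono) auto
    also have "\<dots> \<le> M ^ j"
      using True M by (intro self_le_power) auto
    finally show ?thesis .
  next
    case False
    then have "fps_nth (T i) j = 0" by (auto simp: T_nth \<phi>0)
    then show ?thesis using M by simp
  qed
  define b where "b = (\<lambda>i. mseries_subst n (mseries_deriv i A) T)"
  have b_bound: "vnorm (fps_nth (b i) l) \<le> R * M ^ l" if "i \<le> n" for i l
    unfolding b_def using that R M
    by (intro mseries_subst_nth_bound[where R = R] mseries_deriv_bound T_bound) auto
  have b_eq: "fps_nth (b i) l = fps_nth (a i) l" if "l \<le> N" for i l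
    unfolding b_def a_def linearized_def using that
    by (intro mseries_subst_nth_cong) (auto simp: T_nth q_dilate_def)
  \<comment> \<open>Beyond \<open>N\<close> the coefficients of \<open>b\<close> need not agree with
    those of \<open>a\<close>, but there the inequality holds for every \<open>i \<le> n\<close>: by
    \<open>N'\<close>, or trivially if \<open>p = n\<close>.\<close>
  have b_slope: "real i \<le> real p + \<rho> * (real l - real m)"
    if "i \<le> n" "m < l" "fps_nth (b i) l \<noteq> 0" for i l
  proof (cases "l \<le> N")
    case True
    then show ?thesis
      using slope[OF that(1), of l] that(3) by (simp add: b_eq a_def)
  next
    case False
    show ?thesis
    proof (cases "p = n")
      case True
      then show ?thesis
        using that \<rho> by (simp add: add_increasing2)
    next
      case False
      then have "0 < \<rho>" using \<rho> by auto
      have "2 * real n \<le> \<rho> * (real N + 1 - 2 * real m)"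
        using N' \<open>0 < \<rho>\<close> .
      also have "\<dots> \<le> \<rho> * (real l - real m)"
        using \<open>\<not> l \<le> N\<close> \<open>0 < \<rho>\<close> by (intro mult_left_mono) auto
      finally show ?thesis
        using that(1) by linarith
    qed
  qed
  \<comment> \<open>\<open>K\<close> dominates the three costs to come: of the Taylor remainder, of
    the truncation alone, and of one index step in the linear terms. The factor
    \<open>max 1 (1 / c)\<close> in \<open>C\<close> pays for dividing by \<open>c\<close>.\<close>
  define K where "K = R ^ 2 * Q ^ (n * m) * M ^ (N + m + 1)"
  define C where "C = K * max 1 (1 / c)"
  have one_le: "1 \<le> R ^ 2" "1 \<le> Q ^ (n * m)" "1 \<le> M ^ (N + m + 1)"
    using R(1) Q M by (intro one_le_power; simp)+
  have K_ge: "R ^ 2 * Q ^ (n * m) \<le> K" "M ^ (N + m + 1) \<le> K" "R * M ^ (m + 1) \<le> K"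
  proof -
    show "R ^ 2 * Q ^ (n * m) \<le> K"
      unfolding K_def using mult_left_mono[OF one_le(3), of "R ^ 2 * Q ^ (n * m)"] one_le by simp
    have "1 * 1 \<le> R ^ 2 * Q ^ (n * m)"
      using one_le by (intro mult_mono) auto
    then show "M ^ (N + m + 1) \<le> K"
      unfolding K_def using mult_right_mono[of 1 "R ^ 2 * Q ^ (n * m)" "M ^ (N + m + 1)"] one_le by simp
    have "R * 1 * M ^ (m + 1) \<le> R ^ 2 * Q ^ (n * m) * M ^ (N + m + 1)"
      using R(1) M one_le self_le_power[of R 2]
      by (intro mult_mono power_increasing) auto
    then show "R * M ^ (m + 1) \<le> K"
      by (simp add: K_def)
  qed
  have K: "1 \<le> K" "M \<le> K"
    using K_ge(2) one_le(3) M self_le_power[of M "N + m + 1"] by linarith+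
  have C: "1 \<le> C" "M \<le> C"
    using mult_mono[of 1 K 1 "max 1 (1 / c)"] mult_mono[of M K 1 "max 1 (1 / c)"] K M
    by (auto simp: C_def)
  have KC: "K ^ k \<le> c * C ^ k" if "0 < k" for k
  proof -
    have "1 / c \<le> max 1 (1 / c) ^ k"
      using that self_le_power[of "max 1 (1 / c)" k] by (auto intro: order_trans)
    then have "K ^ k * (1 / c) \<le> C ^ k"
      unfolding C_def power_mult_distrib using K by (intro mult_left_mono) auto
    then show ?thesis
      using c by (simp add: field_simps)
  qed

  \<comment> \<open>The induction on the index\<close>
  have bound: "vnorm (fps_nth \<phi> h) \<le> C ^ (h - N) * Q powr \<gamma> h" if "N < h" for h
    using that
  proof (induction h rule: less_induct)
    case (less h)
    have h: "N < h" by fact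
    \<comment> \<open>\<open>X\<close> is the claimed bound times \<open>c * Q ^ (p * h)\<close>,
      the norm in \<open>main\<close>; everything except the dominant term has to be at most
      \<open>X\<close>.\<close>
    define X where "X = c * C ^ (h - N) * Q powr (p * h + \<gamma> h)"
    have \<gamma>h: "0 \<le> \<gamma> h"
      using h \<rho> by (auto simp: \<gamma>_def)
    have X_ge: "u * Q powr e \<le> X" if "u \<le> c * C ^ (h - N)" "e \<le> p * h + \<gamma> h" "0 \<le> u" for u e
      unfolding X_def using that Q c C by (intro mult_mono powr_mono) auto
    have X: "0 \<le> X" unfolding X_def using c C by simp
    define B1 where "B1 = (\<lambda>j. if N < j then R * C ^ (j - N) *
      Q powr (real (n * j) + \<rho> * (real j * (real j - 1) / 2)) else 0)"
    define B2 where "B2 = (\<lambda>j. if 2 * N + 2 \<le> j then R ^ 2 * C ^ (j - 2 * N) *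
      Q powr (real (n * j) + \<rho> * (real j * (real j - real N - 2) / 2)) else 0)"
    interpret jet_majorants "\<lambda>j. M ^ j" B1 B2 h "Suc (h + m)"
      unfolding B1_def B2_def
      by (rule qgevrey_jet_majorants) (use Q R M C \<rho> N h in auto)
    have "majorized B1 h R (\<Psi> i)" if "i \<le> n" for i
      unfolding majorized_def
    proof (intro allI impI)
      fix j assume "j < h"
      show "R * vnorm (fps_nth (\<Psi> i) j) \<le> B1 j"
      proof (cases "N < j")
        case True
        have "vnorm (fps_nth (\<Psi> i) j) \<le> Q ^ (n * j) * vnorm (fps_nth \<phi> j)"
          using True vnorm_dilate[OF that, of j] by (simp add: \<Psi>_nth)
        also have "\<dots> \<le> Q ^ (n * j) * (C ^ (j - N) * Q powr \<gamma> j)"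
          using less.IH[OF \<open>j < h\<close> True] Q by (intro mult_left_mono) auto
        also have "\<dots> = C ^ (j - N) * Q powr (real (n * j) + \<gamma> j)"
          using Q by (simp add: powr_add powr_realpow[symmetric] del: of_nat_mult)
        finally show ?thesis
          using True R(1) by (simp add: B1_def \<gamma>_def mult.assoc)
      qed (simp add: \<Psi>_nth B1_def)
    qed
    moreover have "majorized (\<lambda>j. M ^ j) (Suc (h + m)) R (fps_X :: 'a fps)"
      using M by (auto simp: majorized_def fps_X_def)
    ultimately have taylor: "vnorm (fps_nth (mseries_subst n A (\<lambda>i. T i + \<Psi> i)) (h + m) -
        fps_nth (mseries_subst n A T) (h + m) - (\<Sum>i\<le>n. fps_nth (b i * \<Psi> i) (h + m))) \<le> B2 (h + m)"
      unfolding b_def using R T_bound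
      by (intro mseries_subst_taylor[where w = R])
        (auto simp: majorized_def T_nth \<Psi>_nth \<phi>0)
    have "B2 (h + m) \<le> X"
    proof (cases "2 * N + 2 \<le> h + m")
      case True
      define E where "E = real (n * (h + m)) + \<rho> * (real (h + m) * (real (h + m) - real N - 2) / 2)"
      \<comment> \<open>The term h (N + 1 - 2m) is the gain from having two factors above
        \<open>N\<close>; times \<open>\<rho>\<close> / 2 it compensates \<open>n * h\<close>
        against \<open>p * h\<close> when \<open>p < n\<close>.\<close>
      have quad: "real (h + m) * (real (h + m) - real N - 2) \<le>
          real h * (real h - 1) - real h * (real N + 1 - 2 * real m)"
      proof -
        have "real m * (real m - real N - 2) \<le> 0"
          using N by (intro mult_nonneg_nonpos) auto
        then show ?thesis by (simp add: algebra_simps)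
      qed
      have "E - real (n * m) \<le> real (p * h) + \<gamma> h"
      proof -
        have "E - real (n * m) \<le> real (n * h) +
            \<rho> * ((real h * (real h - 1) - real h * (real N + 1 - 2 * real m)) / 2)"
        proof -
          have "real (n * (h + m)) = real (n * h) + real (n * m)"
            by (simp add: distrib_left)
          moreover have "\<rho> * (real (h + m) * (real (h + m) - real N - 2) / 2) \<le>
              \<rho> * ((real h * (real h - 1) - real h * (real N + 1 - 2 * real m)) / 2)"
            by (intro mult_left_mono divide_right_mono quad \<rho>(1)) simp
          ultimately show ?thesis
            unfolding E_def by linarith
        qed
        also have "\<dots> = real (n * h) + \<gamma> h - real h * (\<rho> * (real N + 1 - 2 * real m)) / 2"
          by (simp add: \<gamma>_def field_simps)
        also have "\<dots> \<le> real (p * h) + \<gamma> h"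
        proof (cases "p = n")
          case True
          have "0 \<le> real h * (\<rho> * (real N + 1 - 2 * real m))"
            using N \<rho> by auto
          with True show ?thesis by simp
        next
          case False
          then have "real h * (2 * real n) \<le> real h * (\<rho> * (real N + 1 - 2 * real m))"
            using N' \<rho> by (intro mult_left_mono) auto
          moreover have "real (n * h) = real h * (2 * real n) / 2" by simp
          moreover have "0 \<le> real (p * h)" by simp
          ultimately show ?thesis by linarith
        qed
        finally show ?thesis .
      qed
      moreover have "R ^ 2 * C ^ (h + m - 2 * N) * Q ^ (n * m) \<le> c * C ^ (h - N)"
      proof -
        \<comment> \<open>One power of \<open>C\<close> pays the prefactor, and
          \<open>m + 1 \<le> N\<close> leaves room for it.\<close>
        have "R ^ 2 * Q ^ (n * m) \<le> c * C"
          using K_ge(1) KC[of 1] by simp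
        then have "R ^ 2 * Q ^ (n * m) * C ^ (h + m - 2 * N) \<le> c * C * C ^ (h + m - 2 * N)"
          using C by (intro mult_right_mono) auto
        also have "\<dots> = c * C ^ Suc (h + m - 2 * N)"
          by simp
        also have "\<dots> \<le> c * C ^ (h - N)"
          using c C N True by (intro mult_left_mono power_increasing) auto
        finally show ?thesis by (simp add: mult_ac)
      qed
      ultimately have "R ^ 2 * C ^ (h + m - 2 * N) * Q ^ (n * m) * Q powr (E - real (n * m)) \<le> X"
        using R C Q by (intro X_ge) auto
      moreover have "Q powr E = Q ^ (n * m) * Q powr (E - real (n * m))"
        using Q by (simp add: powr_diff powr_realpow del: of_nat_mult)
      ultimately show ?thesis
        using True by (simp add: B2_def E_def mult.assoc)
    qed (use X in \<open>simp add: B2_def\<close>)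
    with taylor have rem: "vnorm (- fps_nth (mseries_subst n A T) (h + m) -
        (\<Sum>i\<le>n. fps_nth (b i * \<Psi> i) (h + m))) \<le> X"
      by (simp add: T\<Psi> sol)
    have "vnorm (fps_nth (mseries_subst n A T) (h + m)) \<le> 1 * M ^ (h + m)"
      using R M T_bound by (intro mseries_subst_nth_bound[where R = R]) auto
    also have "\<dots> \<le> c * C ^ (h - N) * Q powr 0"
    proof -
      obtain u where u: "h = N + Suc u"
        using h less_imp_Suc_add by auto
      \<comment> \<open>Since \<open>h - N\<close> is at least 1, h + m \<le> (N + m + 1)(h - N).
        Hence \<open>h = N + 1\<close> needs no separate base case.\<close>
      have "M ^ (h + m) \<le> M ^ ((N + m + 1) * (h - N))"
        using M u by (intro power_increasing) (auto simp: algebra_simps)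
      also have "\<dots> \<le> K ^ (h - N)"
        unfolding power_mult using K_ge(2) M by (intro power_mono) auto
      also have "\<dots> \<le> c * C ^ (h - N)"
        using h by (intro KC) auto
      finally show ?thesis using Q by simp
    qed
    also have "\<dots> \<le> X"
      using \<gamma>h c C by (intro X_ge) auto
    finally have const: "vnorm (fps_nth (mseries_subst n A T) (h + m)) \<le> X" .
    \<comment> \<open>For l < m the coefficient of \<open>b\<close> vanishes by \<open>ord\<close>,
      and for h + m - l \<le> N that of \<open>\<Psi>\<close> does; otherwise the induction
      hypothesis applies at h - (l - m).\<close>
    have lin: "vnorm (fps_nth (b i) l * fps_nth (\<Psi> i) (h + m - l)) \<le> X"
      if i: "i \<le> n" and l: "l \<in> {0..h + m} - {m}" for i l
    proof (cases "m < l \<and> N < h + m - l \<and> fps_nth (b i) l \<noteq> 0")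
      case True
      define h' t where "h' = h + m - l" and "t = l - m"
      have ht: "h = h' + t" "0 < t" "l = m + t" "N < h'" "h' < h"
        using True by (auto simp: h'_def t_def)
      have "vnorm (fps_nth (\<Psi> i) h') = Q ^ (i * h') * vnorm (fps_nth \<phi> h')"
        using ht by (simp add: \<Psi>_nth vnorm_mult vnorm_power Q_def)
      also have "\<dots> \<le> Q ^ (i * h') * (C ^ (h' - N) * Q powr \<gamma> h')"
        using less.IH[OF \<open>h' < h\<close> \<open>N < h'\<close>] Q by (intro mult_left_mono) auto
      also have "\<dots> = C ^ (h' - N) * Q powr (i * h' + \<gamma> h')"
        using Q by (simp add: powr_add powr_realpow[symmetric] del: of_nat_mult)
      finally have "vnorm (fps_nth (b i) l) * vnorm (fps_nth (\<Psi> i) h') \<le>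
          R * M ^ l * (C ^ (h' - N) * Q powr (i * h' + \<gamma> h'))"
        using b_bound[OF i] R M by (intro mult_mono) auto
      also have "\<dots> = R * M ^ l * C ^ (h' - N) * Q powr (i * h' + \<gamma> h')"
        by (simp add: mult.assoc)
      also have "\<dots> \<le> X"
      proof (rule X_ge)
        have "R * M ^ l \<le> R ^ t * M ^ ((m + 1) * t)"
          using R M ht self_le_power[of R t] by (intro mult_mono power_increasing) auto
        also have "\<dots> = (R * M ^ (m + 1)) ^ t"
          by (simp only: power_mult_distrib power_mult)
        also have "\<dots> \<le> K ^ t"
          using K_ge(3) R M by (intro power_mono) auto
        also have "\<dots> \<le> c * C ^ t"
          using ht by (intro KC) auto
        finally have "R * M ^ l * C ^ (h' - N) \<le> c * C ^ t * C ^ (h' - N)"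
          using C by (intro mult_right_mono) auto
        also have "\<dots> = c * C ^ (h - N)"
          using ht by (simp add: power_add[symmetric] mult.assoc add.commute)
        finally show "R * M ^ l * C ^ (h' - N) \<le> c * C ^ (h - N)" .
        \<comment> \<open>The slope permits a loss of \<open>\<rho> * t * h'\<close>, and the
          quadratic growth from \<open>\<gamma> h'\<close> to \<open>\<gamma> h\<close> supplies at
          least that much.\<close>
        have "real i * real h' \<le> (real p + \<rho> * (real l - real m)) * real h'"
          using b_slope[OF i, of l] True by (intro mult_right_mono) auto
        also have "\<dots> = real p * real h' + \<rho> * real t * real h'"
          using ht by (simp add: algebra_simps)
        also have "\<dots> \<le> real p * real h + \<gamma> h - \<gamma> h'"
        proof -
          have "\<gamma> h - \<gamma> h' = \<rho> * real t * real h' + \<rho> * (real t * (real t - 1) / 2)"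
            by (simp add: \<gamma>_def ht(1) field_simps)
          moreover have "0 \<le> \<rho> * (real t * (real t - 1) / 2)"
            using \<rho> ht by auto
          moreover have "real p * real h' \<le> real p * real h"
            using ht by (intro mult_left_mono) auto
          ultimately show ?thesis by linarith
        qed
        finally show "real (i * h') + \<gamma> h' \<le> real (p * h) + \<gamma> h"
          by simp
        show "0 \<le> R * M ^ l * C ^ (h' - N)"
          using R M C by auto
      qed
      finally show ?thesis
        by (simp add: vnorm_mult h'_def)
    next
      case False
      have "fps_nth (b i) l = 0" if "l < m"
        using ord[OF i that] b_eq[of l i] that N by (simp add: a_def)
      with False l X show ?thesis
        by (auto simp: \<Psi>_nth)
    qed
    define rest where "rest = (\<Sum>i\<le>n. \<Sum>l\<in>{0..h + m} - {m}. fps_nth (b i) l * fps_nth (\<Psi> i) (h + m - l))"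
    have rest: "vnorm rest \<le> X"
      unfolding rest_def using X lin by (intro vnorm_sum_le) auto
    have "(\<Sum>i\<le>n. fps_nth (b i * \<Psi> i) (h + m)) =
        (\<Sum>i\<le>n. fps_nth (b i) m * fps_nth (\<Psi> i) h) + rest"
      unfolding rest_def sum.distrib[symmetric] fps_mult_nth
      by (intro sum.cong) (auto simp: sum.remove[of _ m])
    also have "(\<Sum>i\<le>n. fps_nth (b i) m * fps_nth (\<Psi> i) h) =
        (\<Sum>i\<le>n. fps_nth (a i) m * q ^ (i * h)) * fps_nth \<phi> h"
      using h N by (simp add: b_eq \<Psi>_nth sum_distrib_right mult.assoc)
    \<comment> \<open>The equation, already used in \<open>rem\<close>, isolates the dominant term
      as a combination of quantities bounded by \<open>X\<close>.\<close>
    finally have "(\<Sum>i\<le>n. fps_nth (a i) m * q ^ (i * h)) * fps_nth \<phi> h =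
        - ((- fps_nth (mseries_subst n A T) (h + m) - (\<Sum>i\<le>n. fps_nth (b i * \<Psi> i) (h + m))) +
          (fps_nth (mseries_subst n A T) (h + m) + rest))"
      by simp
    also have "vnorm \<dots> \<le> X"
      unfolding vnorm_minus by (intro vnorm_add_le rem const rest)
    finally have "c * Q ^ (p * h) * vnorm (fps_nth \<phi> h) \<le> X"
      using main[of h] N h by (simp add: vnorm_mult)
    also have "X = c * Q ^ (p * h) * (C ^ (h - N) * Q powr \<gamma> h)"
      using Q by (simp add: X_def powr_add powr_realpow[symmetric] del: of_nat_mult)
    finally show ?case
      using c Q by (simp add: mult_le_cancel_left)
  qed
  show ?thesis
    using C(1) bound by (intro that[of C N]) (auto simp: \<gamma>_def Q_def)
qed

section \<open>From the coefficient bound to the q-Gevrey order\<close>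

lemma q_gevreyI:
  fixes \<phi> :: "'a::complete_ultrametric_field fps"
  assumes q: "q \<noteq> 0" and "1 \<le> C"
    and bound: "\<And>h. N < h \<Longrightarrow> vnorm (fps_nth \<phi> h) \<le> C ^ (h - N) * vnorm q powr (s * (real h * (real h - 1) / 2))"
  shows "q_gevrey q s \<phi>"
proof -
  have "root h (vnorm (fps_nth \<phi> h) * vnorm q powr (- s * (real h * (real h - 1) / 2))) \<le> C"
    if "N < h" for h
  proof -
    let ?e = "s * (real h * (real h - 1) / 2)"
    have "vnorm (fps_nth \<phi> h) * vnorm q powr (- s * (real h * (real h - 1) / 2)) \<le>
        (C ^ (h - N) * vnorm q powr ?e) * vnorm q powr (- ?e)"
      using mult_right_mono[OF bound[OF that], of "vnorm q powr (- ?e)"] by simp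
    also have "\<dots> = C ^ (h - N)"
      using q by (simp add: powr_minus)
    also have "\<dots> \<le> C ^ h"
      using assms(2) by (intro power_increasing) auto
    finally have "root h (vnorm (fps_nth \<phi> h) * vnorm q powr (- s * (real h * (real h - 1) / 2))) \<le> root h (C ^ h)"
      using that by (intro real_root_le_mono) auto
    also have "root h (C ^ h) = C"
      using that assms(2) by (simp add: real_root_power_cancel)
    finally show ?thesis .
  qed
  then have "limsup (\<lambda>h. ereal (root h (vnorm (fps_nth \<phi> h) *
       vnorm q powr (- s * (real h * (real h - 1) / 2))))) \<le> ereal C"
    by (intro Limsup_bounded eventually_mono[OF eventually_gt_at_top[of N]]) auto
  then show ?thesis
    unfolding q_gevrey_def by (rule le_less_trans) simp
qed

theorem theorem4:
  fixes q :: "'a::complete_ultrametric_field"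
    and n :: nat
    and A :: "'a mseries"
    and \<phi> :: "'a fps"
    and r :: ereal
  assumes "vnorm q > 1"
    and "A 0 (\<lambda>_. 0) = 0"
    and "mseries_analytic n A"
    and "fps_nth \<phi> 0 = 0"
    and "mseries_subst n A (\<lambda>i. q_dilate q i \<phi>) = 0"
    and "r \<in> newton_slopes n (linearized n q A \<phi>)" and "r > 0"
    and "\<And>s. s \<in> newton_slopes n (linearized n q A \<phi>) \<Longrightarrow> s > 0 \<Longrightarrow> r \<le> s"
    and "mseries_subst n (mseries_deriv n A) (\<lambda>i. q_dilate q i \<phi>) \<noteq> 0"
  shows "q_gevrey q (real_of_ereal (1 / r)) \<phi>"
proof -
  define a where "a = linearized n q A \<phi>"
  define \<rho> where "\<rho> = real_of_ereal (1 / r)"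
  define I where "I = {i. i \<le> n \<and> a i \<noteq> 0}"
  have an: "a n \<noteq> 0"
    using assms(9) by (simp add: a_def linearized_def)
  then have I: "finite I" "n \<in> I"
    by (auto simp: I_def)
  define m where "m = Min ((\<lambda>i. subdegree (a i)) ` I)"
  have m_le: "m \<le> subdegree (a i)" if "i \<le> n" "a i \<noteq> 0" for i
    unfolding m_def using I that by (intro Min_le) (auto simp: I_def)
  define P where "P = {i \<in> I. subdegree (a i) = m}"
  have "m \<in> (\<lambda>i. subdegree (a i)) ` I"
    unfolding m_def using I by (intro Min_in) auto
  then have P: "finite P" "P \<noteq> {}"
    using I by (auto simp: P_def)
  define p where "p = Max P"
  have p: "p \<le> n" "a p \<noteq> 0" "subdegree (a p) = m"
    using Max_in[OF P] by (auto simp: p_def P_def I_def)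
  have last: "m < subdegree (a i)" if "p < i" "i \<le> n" "a i \<noteq> 0" for i
  proof (rule ccontr)
    assume "\<not> m < subdegree (a i)"
    then have "i \<in> P"
      using m_le[of i] that by (simp add: P_def I_def)
    then show False
      using Max_ge[OF P(1), of i] that(1) by (simp add: p_def)
  qed
  have \<rho>0: "0 \<le> \<rho>"
    using \<open>r > 0\<close> unfolding \<rho>_def by (cases r) (auto simp: one_ereal_def)
  \<comment> \<open>For \<open>p = n\<close> the left side is never positive. Otherwise a finite
    positive slope exists, so \<open>r\<close> is finite and \<open>\<rho>\<close> positive.\<close>
  have slopes: "(p = n \<or> 0 < \<rho>) \<and> (\<forall>i\<le>n. a i \<noteq> 0 \<longrightarrow> real i - real p \<le> \<rho> * (real (subdegree (a i)) - real m))"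
  proof (cases "p = n")
    case True
    have "real i - real p \<le> \<rho> * (real (subdegree (a i)) - real m)" if "i \<le> n" "a i \<noteq> 0" for i
    proof -
      have "0 \<le> \<rho> * (real (subdegree (a i)) - real m)"
        using \<rho>0 m_le[OF that] by simp
      with True that show ?thesis by simp
    qed
    with True show ?thesis by simp
  next
    case False
    then obtain \<sigma> where \<sigma>: "\<sigma> > 0" "ereal \<sigma> \<in> newton_slopes n a"
        "\<And>i. i \<le> n \<Longrightarrow> a i \<noteq> 0 \<Longrightarrow> m + \<sigma> * (real i - real p) \<le> subdegree (a i)"
      using exists_positive_slope[of p n a] p an m_le last by auto
    have "r \<le> ereal \<sigma>"
      using assms(8)[of "ereal \<sigma>"] \<sigma> by (simp add: a_def)
    with \<open>r > 0\<close> obtain r' where r': "r = ereal r'" "0 < r'" "r' \<le> \<sigma>"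
      by (cases r) auto
    then have \<rho>: "\<rho> = 1 / r'" "0 < \<rho>"
      by (auto simp: \<rho>_def one_ereal_def)
    \<comment> \<open>Lowering the slope from \<open>\<sigma>\<close> to \<open>r'\<close> weakens
      the supporting inequality to the right of \<open>p\<close>; to the left the signs
      suffice.\<close>
    have "real i - real p \<le> \<rho> * (real (subdegree (a i)) - real m)" if i: "i \<le> n" "a i \<noteq> 0" for i
    proof (cases "p \<le> i")
      case True
      have "r' * (real i - real p) \<le> \<sigma> * (real i - real p)"
        using True r' by (intro mult_right_mono) auto
      with \<sigma>(3)[OF i] have "r' * (real i - real p) \<le> real (subdegree (a i)) - real m"
        by simp
      then show ?thesis
        using r' by (simp add: \<rho>(1) pos_le_divide_eq mult.commute)
    next
      case False
      moreover have "0 \<le> \<rho> * (real (subdegree (a i)) - real m)"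
        using \<rho>0 m_le[OF i] by simp
      ultimately show ?thesis by simp
    qed
    with \<rho> show ?thesis by simp
  qed
  obtain R where R: "1 \<le> R" "\<And>k \<kappa>. (k, \<kappa>) \<in> mexps n \<Longrightarrow> vnorm (A k \<kappa>) \<le> R ^ mdeg n (k, \<kappa>)"
    using mseries_analytic_bound[OF assms(3,2)] by blast
  have ord: "fps_nth (a i) j = 0" if "i \<le> n" "j < m" for i j
  proof (cases "a i = 0")
    case False
    then show ?thesis
      using m_le[OF that(1)] that(2) by (intro nth_less_subdegree_zero) linarith
  qed simp
  have slope: "real i - real p \<le> \<rho> * (real j - real m)" if "i \<le> n" "fps_nth (a i) j \<noteq> 0" for i j
  proof -
    have "subdegree (a i) \<le> j" "a i \<noteq> 0"
      using that(2) by (auto intro: subdegree_leI)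
    then have "real i - real p \<le> \<rho> * (real (subdegree (a i)) - real m)"
      using slopes that(1) by simp
    also have "\<dots> \<le> \<rho> * (real j - real m)"
      using \<open>subdegree (a i) \<le> j\<close> \<rho>0 by (intro mult_left_mono) auto
    finally show ?thesis .
  qed
  have "fps_nth (a p) m \<noteq> 0"
    using p by (metis nth_subdegree_nonzero)
  then obtain C N where "1 \<le> C"
    "\<And>h. N < h \<Longrightarrow> vnorm (fps_nth \<phi> h) \<le> C ^ (h - N) * vnorm q powr (\<rho> * (real h * (real h - 1) / 2))"
    using solution_coeff_bound[OF assms(1) R assms(4,5) p(1), of m \<rho>] ord slope \<rho>0 slopes
    unfolding a_def by blast
  moreover have "q \<noteq> 0"
    using assms(1) by auto
  ultimately show ?thesis
    unfolding \<rho>_def by (intro q_gevreyI)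
qed


end
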